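(* Let $G$ be a non-supersolvable finite group of order $n$ such that $\psi(G)=\frac{31}{77}\psi(C_n)$. Then $G\cong A_4\times C_m$ for some positive integer $m$ with $\gcd(6,m)=1$.
   Context: All groups are finite. For a finite group $G$, $\psi(G)=\sum_{g\in G} o(g)$, where $o(g)$ is the order of $g$. $C_n$ denotes the cyclic group of order $n$; $A_4$ is the alternating group of degree 4. *)

theory Defs
  imports "HOL-Algebra.Algebra"
begin

definition psi :: "('a, 'b) monoid_scheme \<Rightarrow> nat" where
  "psi G = (\<Sum>g\<in>carrier G. group.ord G g)"

definition supersolvable :: "('a, 'b) monoid_scheme \<Rightarrow> bool" where
  "supersolvable G \<longleftrightarrow>
     (\<exists>(k::nat) (H::nat \<Rightarrow> 'a set).
        H 0 = {\<one>\<^bsub>G\<^esub>} \<and> H k = carrier G \<and>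
        (\<forall>i\<le>k. H i \<lhd> G) \<and>
        (\<forall>i<k. H i \<subseteq> H (Suc i) \<and>
               cyclic_group ((G\<lparr>carrier := H (Suc i)\<rparr>) Mod (H i))))"

end

theory Submission
  imports Defs "HOL-Number_Theory.Totient"
begin

text \<open>
  Write \<open>\<Psi>(n) = \<psi>(C\<^sub>n)\<close>. Since \<open>\<psi>(G) \<le> n max o(x)\<close> and \<open>\<Psi>(n) \<ge> n\<^sup>2 \<Prod> q/(q+1)\<close> over the primes
  dividing \<open>n\<close>, the hypothesis yields a cyclic subgroup \<open>C = \<langle>x\<rangle>\<close> of small index. A group with a
  cyclic subgroup of prime index is supersolvable, so the index is not prime.

  If the largest prime divisor \<open>p\<close> of \<open>n\<close> is at least \<open>5\<close>, the index is less than \<open>p\<close>, and the Sylow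
  \<open>p\<close>-subgroup \<open>P\<close> is cyclic and normal. Then \<open>\<psi>(G) \<le> \<psi>(P) \<psi>(G/P)\<close>, with equality only if \<open>P\<close>
  is central, and by induction \<open>G/P\<close> attains the bound; hence \<open>P\<close> is central and splits off.

  If \<open>n = 2\<^sup>a 3\<^sup>b\<close>, the index is \<open>4\<close>, and \<open>x\<close> must permute the three cosets other than \<open>C\<close>
  cyclically. Then \<open>K = \<langle>x\<^sup>3\<rangle>\<close> is central with \<open>G/K\<close> isomorphic to \<open>A\<^sub>4\<close>, and counting orders in
  the conjugates of \<open>C\<close> and in their complement shows that \<open>K\<close> is trivial.
\<close>

section \<open>The order sum of a cyclic group\<close>

text \<open>The constant is the value of the smallest example: the orders in
  \<open>A\<^sub>4\<close> give 1 + 3*2 + 8*3 = 31, and Psi(12) = Psi(4) Psi(3) = 11*7 = 77. The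
  argument works because 77/31 lies just below 5/2. Twice this number is below 5, which bounds the
  index by 4 when only 2 and 3 divide n; its multiple by 2(p+1)/5 is below p+1, which bounds the
  index by p when the largest prime p is at least 5. The values p, 3 and 2 are then excluded as
  prime indices. The obstacle to the induction is that dividing by P passes on only an inequality.
  The induction therefore runs over non-supersolvable groups with psi(G) >= 31/77 Psi(n), and
  equality becomes part of the conclusion. Equality for G/P together with the lower bound for G
  leaves no slack, and this makes P central. Non-supersolvability passes to G/P because a group with
  a cyclic normal subgroup and supersolvable quotient is supersolvable.\<close>

definition cyclic_psi :: "nat \<Rightarrow> nat" where
  "cyclic_psi n = (\<Sum>d | d dvd n. d * totient d)"

lemma cyclic_psi_1 [simp]: "cyclic_psi (Suc 0) = 1"
  by (simp add: cyclic_psi_def)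

lemma cyclic_psi_mult_coprime:
  assumes "coprime a b" "a > 0" "b > 0"
  shows "cyclic_psi (a * b) = cyclic_psi a * cyclic_psi b"
proof -
  have "cyclic_psi a * cyclic_psi b =
      (\<Sum>(i, j) \<in> {i. i dvd a} \<times> {j. j dvd b}. (i * totient i) * (j * totient j))"
    by (simp add: cyclic_psi_def sum_product sum.cartesian_product)
  also have "\<dots> = (\<Sum>d | d dvd a * b. d * totient d)"
  \<comment> \<open>A divisor of \<open>a * b\<close> splits uniquely into divisors of the coprime
    factors; the two gcds recover them.\<close>
  proof (rule sum.reindex_bij_witness[of _ "\<lambda>d. (gcd d a, gcd d b)" "\<lambda>(i, j). i * j"])
    fix ij assume "ij \<in> {i. i dvd a} \<times> {j. j dvd b}"
    then obtain i j where ij: "ij = (i, j)" "i dvd a" "j dvd b" by auto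
    have "coprime i b" "coprime j a" "coprime i j"
      using assms(1) ij coprime_divisors[of i a b b] coprime_divisors[of j b a a]
        coprime_divisors[of i a j b] by (auto simp: coprime_commute)
    then have "gcd (i * j) a = i" "gcd (i * j) b = j"
      using ij by (auto simp: gcd_mult_right_right_cancel gcd_mult_left_right_cancel
          gcd_mult_left_left_cancel coprime_commute gcd_proj1_if_dvd)
    then show "(\<lambda>d. (gcd d a, gcd d b)) ((\<lambda>(i, j). i * j) ij) = ij" using ij by simp
    show "(\<lambda>(i, j). i * j) ij \<in> {d. d dvd a * b}" using ij by (simp add: mult_dvd_mono)
    show "(\<lambda>(i, j). i * j) ij * totient ((\<lambda>(i, j). i * j) ij) =
      (case ij of (i, j) \<Rightarrow> i * totient i * (j * totient j))"
      using ij \<open>coprime i j\<close> by (simp add: totient_mult_coprime)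
  next
    fix d assume "d \<in> {d. d dvd a * b}"
    then obtain i j where d: "d = i * j" "i dvd a" "j dvd b"
      using division_decomp[of d a b] by auto
    have "coprime i b" "coprime j a"
      using assms(1) d coprime_divisors[of i a b b] coprime_divisors[of j b a a] 
      by (auto simp: coprime_commute)
    then have "gcd (i * j) a = i" "gcd (i * j) b = j"
      using d by (auto simp: gcd_mult_right_right_cancel gcd_mult_left_right_cancel
          gcd_mult_left_left_cancel coprime_commute gcd_proj1_if_dvd)
    then show "(\<lambda>(i, j). i * j) (gcd d a, gcd d b) = d" using d by simp
  qed auto
  finally show ?thesis by (simp add: cyclic_psi_def)
qed

text \<open>An alternating geometric sum, multiplied out by \<open>p + 1\<close> to stay in the
  natural numbers.\<close>

lemma cyclic_psi_prime_power:
  assumes "Factorial_Ring.prime p"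
  shows "(p + 1) * cyclic_psi (p ^ a) = p ^ (2 * a + 1) + 1"
proof (induction a)
  case 0
  then show ?case by simp
next
  case (Suc a)
  have "{d. d dvd p ^ Suc a} = insert (p ^ Suc a) {d. d dvd p ^ a}"
    unfolding divides_primepow_nat[OF assms] by (auto simp del: power_Suc simp: le_Suc_eq)
  moreover have "p ^ Suc a \<notin> {d. d dvd p ^ a}"
    using prime_gt_1_nat[OF assms] by (simp add: nat_dvd_not_less)
  ultimately have "cyclic_psi (p ^ Suc a) = p ^ Suc a * totient (p ^ Suc a) + cyclic_psi (p ^ a)"
    using assms prime_gt_0_nat[OF assms] by (simp add: cyclic_psi_def)
  then have "(p + 1) * cyclic_psi (p ^ Suc a) =
      (p + 1) * (p ^ Suc a * (p ^ a * (p - 1))) + (p ^ (2 * a + 1) + 1)"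
    using Suc by (simp only: totient_prime_power_Suc[OF assms] distrib_left)
  also have "\<dots> = p ^ (2 * Suc a + 1) + 1"
  proof -
    obtain q where "p = Suc q" using prime_gt_0_nat[OF assms] by (cases p) auto
    moreover have "p ^ (a * 2) = p ^ a * p ^ a" by (simp add: power_mult power2_eq_square)
    ultimately show ?thesis by (simp add: algebra_simps)
  qed
  finally show ?case .
qed

text \<open>The recursion Psi(p^(a+1)) = p^2 Psi(p^a) - (p - 1), written without truncated
  subtraction. It later expresses the values for \<open>12 * card K\<close> and
  \<open>3 * card K\<close> through those for \<open>card K\<close>.\<close>

lemma cyclic_psi_prime_power_Suc:
  assumes "Factorial_Ring.prime p"
  shows "cyclic_psi (p ^ Suc a) + p = p\<^sup>2 * cyclic_psi (p ^ a) + 1"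
proof -
  have "(p + 1) * (cyclic_psi (p ^ Suc a) + p) = p ^ (2 * Suc a + 1) + 1 + (p + 1) * p"
    using cyclic_psi_prime_power[OF assms, of "Suc a"] by (simp only: distrib_left)
  also have "\<dots> = p\<^sup>2 * (p ^ (2 * a + 1) + 1) + (p + 1)"
    by (simp add: algebra_simps power2_eq_square)
  also have "\<dots> = (p + 1) * (p\<^sup>2 * cyclic_psi (p ^ a) + 1)"
    by (simp only: cyclic_psi_prime_power[OF assms, of a, symmetric]) (simp add: algebra_simps)
  finally show ?thesis by (simp only: mult_cancel1) auto
qed

text \<open>Dropping the summand 1 in the closed form gives Psi(p^c) >= p^(2c) p/(p+1);
  multiplicativity does the rest, one full prime power at a time.\<close>

lemma cyclic_psi_prime_factors_bound:
  assumes "n > 0"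
  shows "real (cyclic_psi n) \<ge> real n ^ 2 * (\<Prod>q\<in>prime_factors n. real q / (real q + 1))"
  using assms
proof (induction n rule: less_induct)
  case (less n)
  show ?case
  proof (cases "n = 1")
    case False
    then obtain p where p: "Factorial_Ring.prime p" "p dvd n" using prime_factor_nat by blast
    define c where "c = multiplicity p n"
    obtain m where m: "n = p ^ c * m" "\<not> p dvd m"
      using multiplicity_decompose'[of n p] less.prems p by (metis c_def neq0_conv not_prime_unit)
    have "c > 0" using p m less.prems by (cases c) auto
    have "m > 0" using less.prems m by auto
    have "p ^ c > 1" using p(1) \<open>c > 0\<close> by (metis one_less_power prime_gt_1_nat)
    then have "m < n" using m \<open>m > 0\<close> by simp
    have cop: "coprime (p ^ c) m" using p m by (simp add: prime_imp_coprime)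
    have pf: "prime_factors n = insert p (prime_factors m)"
      using m p \<open>m > 0\<close> \<open>c > 0\<close> by (auto simp: prime_factors_product prime_factors_power prime_prime_factors)
    have notin: "p \<notin> prime_factors m" using m(2) by auto
    have "(real p + 1) * real (cyclic_psi (p ^ c)) = real p ^ (2 * c + 1) + 1"
      using cyclic_psi_prime_power[OF p(1), of c] 
      by (metis (mono_tags) of_nat_1 of_nat_add of_nat_mult of_nat_power)
    then have "(real p + 1) * real (cyclic_psi (p ^ c)) \<ge> real p * (real p ^ c) ^ 2"
      by (simp add: power_mult mult.commute)
    then have 1: "real (cyclic_psi (p ^ c)) \<ge> (real p ^ c) ^ 2 * (real p / (real p + 1))"
      by (simp add: field_simps)
    have "real (cyclic_psi n) = real (cyclic_psi (p ^ c)) * real (cyclic_psi m)"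
      using cyclic_psi_mult_coprime[OF cop _ \<open>m > 0\<close>] m \<open>p ^ c > 1\<close>
      by (metis gr0I not_less_zero of_nat_mult)
    also have "\<dots> \<ge> ((real p ^ c) ^ 2 * (real p / (real p + 1))) *
        (real m ^ 2 * (\<Prod>q\<in>prime_factors m. real q / (real q + 1)))"
      using 1 less.IH[OF \<open>m < n\<close> \<open>m > 0\<close>]
      by (intro mult_mono) (auto intro!: mult_nonneg_nonneg prod_nonneg)
    also have "((real p ^ c) ^ 2 * (real p / (real p + 1))) *
        (real m ^ 2 * (\<Prod>q\<in>prime_factors m. real q / (real q + 1))) =
      real n ^ 2 * (\<Prod>q\<in>prime_factors n. real q / (real q + 1))"
      unfolding pf using notin by (simp add: m(1) power_mult_distrib)
    finally show ?thesis .
  qed simp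
qed

text \<open>Additional factors are below 1 and only weaken the bound. Allowing non-primes in
  \<open>S\<close> is what makes a telescoping product available.\<close>

lemma cyclic_psi_lower_bound:
  assumes "n > 0" "finite S" "prime_factors n \<subseteq> S"
  shows "real (cyclic_psi n) \<ge> real n ^ 2 * (\<Prod>q\<in>S. real q / (real q + 1))"
proof -
  have "(\<Prod>q\<in>S. real q / (real q + 1)) \<le> (\<Prod>q\<in>prime_factors n. real q / (real q + 1))"
  proof -
    have "(\<Prod>q\<in>S - prime_factors n. real q / (real q + 1)) \<le> 1"
      by (intro prod_le_1) auto
    then have "(\<Prod>q\<in>S - prime_factors n. real q / (real q + 1)) *
        (\<Prod>q\<in>prime_factors n. real q / (real q + 1)) \<le> 1 * (\<Prod>q\<in>prime_factors n. real q / (real q + 1))"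
      by (intro mult_right_mono prod_nonneg) auto
    then show ?thesis using assms by (simp add: prod.subset_diff[of "prime_factors n" S])
  qed
  then have "real n ^ 2 * (\<Prod>q\<in>S. real q / (real q + 1)) \<le>
      real n ^ 2 * (\<Prod>q\<in>prime_factors n. real q / (real q + 1))"
    by (intro mult_left_mono) auto
  then show ?thesis using cyclic_psi_prime_factors_bound[OF assms(1)] by linarith
qed

text \<open>The unknown primes from 5 to \<open>p\<close> are replaced by all integers in this
  range, where the product collapses.\<close>

lemma prod_primes_telescope:
  assumes "5 \<le> p"
  shows "(\<Prod>q\<in>{2,3} \<union> {5..p}. real q / (real q + 1)) = 5 / (2 * (real p + 1))"
proof -
  have "(\<Prod>q = 5..p. real q / (real q + 1)) = 5 / (real p + 1)"
    using assms by (induction p rule: dec_induct) (auto simp: prod.nat_ivl_Suc' field_simps)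
  moreover have "(\<Prod>q\<in>{2,3::nat}. real q / (real q + 1)) = 1 / 2" by simp
  ultimately show ?thesis
    by (subst prod.union_disjoint) (simp_all only:, auto)
qed

section \<open>Supersolvable groups\<close>

text \<open>Turns cyclicity of a factor into a condition on elements of \<open>G\<close>, so that a
  series can be pulled back along a homomorphism without comparing quotients of subgroups.\<close>

lemma (in group) cyclic_factor_iff:
  assumes "A \<lhd> G" "subgroup B G" "A \<subseteq> B"
  shows "cyclic_group ((G\<lparr>carrier := B\<rparr>) Mod A) \<longleftrightarrow>
    (\<exists>x\<in>B. \<forall>b\<in>B. \<exists>j::int. b \<otimes> inv (x [^] j) \<in> A)"
proof -
  interpret B: group "G\<lparr>carrier := B\<rparr>" using assms(2) by (rule subgroup_imp_group)
  have sub: "subgroup A G" using assms(1) by (rule normal_imp_subgroup)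
  interpret A: normal A "G\<lparr>carrier := B\<rparr>"
    using normal_restrict_supergroup[OF assms(2,1,3)] .
  interpret Q: group "(G\<lparr>carrier := B\<rparr>) Mod A" by (rule A.factorgroup_is_group)
  have BG: "B \<subseteq> carrier G" using assms(2) by (rule subgroup.subset)
  have pow: "x [^]\<^bsub>G\<lparr>carrier := B\<rparr>\<^esub> j = x [^] j" if "x \<in> B" for x and j :: int
    using int_pow_consistent[OF assms(2) that] by simp
  have car: "carrier ((G\<lparr>carrier := B\<rparr>) Mod A) = (\<lambda>x. A #> x) ` B"
    by (simp add: carrier_FactGroup r_coset_def)
  have rpow: "(A #> x) [^]\<^bsub>(G\<lparr>carrier := B\<rparr>) Mod A\<^esub> j = A #> (x [^] j)" if "x \<in> B" for x and j :: int
    using A.FactGroup_int_pow[of x j] that pow by (simp add: r_coset_def)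
  have eq: "A #> b = A #> c \<longleftrightarrow> b \<otimes> inv c \<in> A" if "b \<in> carrier G" "c \<in> carrier G" for b c
    using that sub by (metis repr_independence rcos_self subgroup.rcos_module is_group)
  have powB: "x [^] j \<in> B" if "x \<in> B" for x and j :: int
    using that assms(2) subgroup_int_pow_closed by blast
  have "cyclic_group ((G\<lparr>carrier := B\<rparr>) Mod A) \<longleftrightarrow>
      (\<exists>x\<in>B. (\<lambda>x. A #> x) ` B = range (\<lambda>j::int. A #> (x [^] j)))"
    unfolding Q.cyclic_group car by (auto simp: rpow)
  also have "\<dots> \<longleftrightarrow> (\<exists>x\<in>B. \<forall>b\<in>B. \<exists>j::int. A #> b = A #> (x [^] j))"
  proof (intro bex_cong refl)
    fix x assume "x \<in> B"
    then have "range (\<lambda>j::int. A #> (x [^] j)) \<subseteq> (\<lambda>x. A #> x) ` B" using powB by auto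
    then have "(\<lambda>x. A #> x) ` B = range (\<lambda>j::int. A #> (x [^] j)) \<longleftrightarrow>
        (\<lambda>x. A #> x) ` B \<subseteq> range (\<lambda>j::int. A #> (x [^] j))" by blast
    then show "((\<lambda>x. A #> x) ` B = range (\<lambda>j::int. A #> (x [^] j))) \<longleftrightarrow>
        (\<forall>b\<in>B. \<exists>j::int. A #> b = A #> (x [^] j))"
      by (simp add: image_subset_iff image_iff)
  qed
  also have "\<dots> \<longleftrightarrow> (\<exists>x\<in>B. \<forall>b\<in>B. \<exists>j::int. b \<otimes> inv (x [^] j) \<in> A)"
    using powB BG by (intro bex_cong ball_cong ex_cong1 refl) (auto intro!: eq)
  finally show ?thesis .
qed

lemma (in group) generate_singleton_cancel:
  assumes "x \<in> carrier G" "b \<in> generate G {x}"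
  shows "\<exists>j::int. b \<otimes> inv (x [^] j) = \<one>"
proof -
  obtain j :: int where "b = x [^] j"
    using assms generate_pow[OF assms(1)] by blast
  then show ?thesis using assms(1) by (intro exI[of _ j]) simp
qed

lemma (in group) supersolvable_iff:
  "supersolvable G \<longleftrightarrow>
    (\<exists>(k::nat) H. H 0 = {\<one>} \<and> H k = carrier G \<and> (\<forall>i\<le>k. H i \<lhd> G) \<and>
      (\<forall>i<k. H i \<subseteq> H (Suc i) \<and>
        (\<exists>x\<in>H (Suc i). \<forall>b\<in>H (Suc i). \<exists>j::int. b \<otimes> inv (x [^] j) \<in> H i)))"
  unfolding supersolvable_def
  by (intro ex_cong1 conj_cong refl all_cong) (simp add: cyclic_factor_iff normal_imp_subgroup)

text \<open>The preimage of a supersolvable series is prefixed with the trivial group; its first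
  factor is the kernel.\<close>

lemma supersolvable_epi:
  assumes "group G" "group Q" "f \<in> epi G Q" "supersolvable Q"
    and x: "x \<in> carrier G" "kernel G Q f = generate G {x}"
  shows "supersolvable G"
proof -
  interpret G: group G by fact
  interpret Q: group Q by fact
  interpret f: group_hom G Q f
    using assms by (simp add: group_hom_def group_hom_axioms_def epi_def)
  have surj: "f ` carrier G = carrier Q" using assms by (simp add: epi_def)
  obtain k :: nat and H where H: "H 0 = {\<one>\<^bsub>Q\<^esub>}" "H k = carrier Q" "\<And>i. i \<le> k \<Longrightarrow> H i \<lhd> Q"
    "\<And>i. i < k \<Longrightarrow> H i \<subseteq> H (Suc i)"
    "\<And>i. i < k \<Longrightarrow> \<exists>x\<in>H (Suc i). \<forall>b\<in>H (Suc i). \<exists>j::int. b \<otimes>\<^bsub>Q\<^esub> inv\<^bsub>Q\<^esub> (x [^]\<^bsub>Q\<^esub> j) \<in> H i"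
    using assms(4) unfolding Q.supersolvable_iff by (elim exE conjE) (erule that, assumption, blast+)
  define K where "K i = (case i of 0 \<Rightarrow> {\<one>\<^bsub>G\<^esub>} | Suc i \<Rightarrow> {g \<in> carrier G. f g \<in> H i})" for i
  have normal: "{g \<in> carrier G. f g \<in> H i} \<lhd> G" if "i \<le> k" for i
  proof -
    interpret N: normal "H i" Q using H(3) that .
    show ?thesis unfolding G.normal_inv_iff
      by (auto intro!: G.subgroupI exI[of _ "\<one>\<^bsub>G\<^esub>"] N.inv_op_closed2)
  qed
  show ?thesis unfolding G.supersolvable_iff
  proof (intro exI[of _ "Suc k"] exI[of _ K] conjI allI impI)
    show "K 0 = {\<one>\<^bsub>G\<^esub>}" "K (Suc k) = carrier G"
      by (auto simp: K_def H(2))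
    show "K i \<lhd> G" if "i \<le> Suc k" for i
      using that normal G.one_is_normal by (auto simp: K_def split: nat.split)
    fix i assume i: "i < Suc k"
    show "K i \<subseteq> K (Suc i)"
      using i H(1,4) by (auto simp: K_def split: nat.split)
    show "\<exists>x\<in>K (Suc i). \<forall>b\<in>K (Suc i). \<exists>j::int. b \<otimes>\<^bsub>G\<^esub> inv\<^bsub>G\<^esub> (x [^]\<^bsub>G\<^esub> j) \<in> K i"
    proof (cases i)
      case 0
      have "K 1 = generate G {x}" using x(2) H(1) by (auto simp: K_def kernel_def)
      moreover have "\<exists>j::int. b \<otimes>\<^bsub>G\<^esub> inv\<^bsub>G\<^esub> (x [^]\<^bsub>G\<^esub> j) = \<one>\<^bsub>G\<^esub>" if "b \<in> generate G {x}" for b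
        using G.generate_singleton_cancel[OF x(1) that] .
      ultimately show ?thesis
        using 0 by (auto simp: K_def intro!: bexI[of _ x] generate.incl)
    next
      case (Suc l)
      then obtain y where y: "y \<in> H (Suc l)"
        "\<And>b. b \<in> H (Suc l) \<Longrightarrow> \<exists>j::int. b \<otimes>\<^bsub>Q\<^esub> inv\<^bsub>Q\<^esub> (y [^]\<^bsub>Q\<^esub> j) \<in> H l"
        using H(5)[of l] i by auto
      have "H (Suc l) \<subseteq> carrier Q"
        using H(3)[of "Suc l"] i Suc by (simp add: normal_imp_subgroup subgroup.subset)
      then obtain z where z: "z \<in> carrier G" "f z = y"
        using y(1) surj by (metis imageE subsetD)
      show ?thesis
        using Suc z y by (auto simp: K_def f.hom_int_pow intro!: bexI[of _ z])
    qed
  qed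
qed

lemma supersolvable_iso:
  assumes "group G" "group Q" "G \<cong> Q" "supersolvable Q"
  shows "supersolvable G"
proof -
  interpret G: group G by fact
  obtain f where f: "f \<in> iso G Q" using assms(3) by (auto simp: is_iso_def)
  interpret f: group_hom G Q f
    using assms f by (simp add: group_hom_def group_hom_axioms_def iso_def)
  have "kernel G Q f = {\<one>\<^bsub>G\<^esub>}"
    using f f.inj_iff_trivial_ker by (simp add: iso_iff_mon_epi mon_def)
  then show ?thesis
    using supersolvable_epi[OF assms(1,2) _ assms(4), of f "\<one>\<^bsub>G\<^esub>"] f G.generate_one
    by (simp add: iso_iff_mon_epi)
qed

context group
begin

text \<open>The projection has kernel \<open>N\<close>, so \<open>supersolvable_epi\<close> applies.
  This is the standard way below to lift supersolvability from a smaller group, and its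
  contrapositive keeps the hypothesis alive in the induction.\<close>

lemma supersolvable_quotient:
  assumes "N \<lhd> G" "x \<in> carrier G" "N = generate G {x}" "supersolvable (G Mod N)"
  shows "supersolvable G"
proof -
  interpret N: normal N G by fact
  have "kernel G (G Mod N) ((#>) N) = N"
    using coset_join1[OF _ _ N.subgroup_axioms] coset_join2[OF _ N.subgroup_axioms]
    by (auto simp: kernel_def)
  moreover have "(#>) N \<in> epi G (G Mod N)"
    using N.r_coset_hom_Mod by (simp add: epi_def carrier_FactGroup)
  ultimately show ?thesis
    using supersolvable_epi[OF is_group N.factorgroup_is_group _ assms(4) assms(2)] assms(3) by simp
qed

lemma supersolvable_cyclic:
  assumes "x \<in> carrier G" "carrier G = generate G {x}"
  shows "supersolvable G"
  unfolding supersolvable_iff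
proof (intro exI[of _ 1] exI[of _ "\<lambda>i. if i = 0 then {\<one>} else carrier G"] conjI allI impI)
  have "\<exists>j::int. b \<otimes> inv (x [^] j) = \<one>" if "b \<in> carrier G" for b
    using that assms generate_singleton_cancel by metis
  then show "\<exists>x\<in>if Suc i = 0 then {\<one>} else carrier G.
      \<forall>b\<in>if Suc i = 0 then {\<one>} else carrier G.
        \<exists>j::int. b \<otimes> inv (x [^] j) \<in> (if i = 0 then {\<one>} else carrier G)" if "i < 1" for i :: nat
    using that assms(1) by auto
qed (auto simp: one_is_normal normal_self)

end

section \<open>Finite groups\<close>

locale finite_group = group +
  assumes finite_carrier [simp, intro]: "finite (carrier G)"
begin

lemma order_pos: "order G > 0"
  by (simp add: order_gt_0_iff_finite)

lemma ord_pos: "x \<in> carrier G \<Longrightarrow> ord x > 0"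
  using ord_ge_1[of x] by simp

lemma pow_mod_ord:
  assumes "x \<in> carrier G"
  shows "x [^] (k mod ord x) = x [^] k"
proof -
  have "x [^] k = x [^] (ord x * (k div ord x)) \<otimes> x [^] (k mod ord x)"
    using assms by (simp add: nat_pow_mult)
  moreover have "x [^] (ord x * (k div ord x)) = \<one>"
    using assms by (simp add: pow_eq_id)
  ultimately show ?thesis using assms by simp
qed

lemma generate_eq_image:
  assumes "x \<in> carrier G"
  shows "generate G {x} = (\<lambda>i::nat. x [^] i) ` {1..ord x}"
proof -
  have "x [^] k \<in> (\<lambda>i::nat. x [^] i) ` {1..ord x}" for k :: nat
  proof (cases "k mod ord x = 0")
    case True
    then have "x [^] k = x [^] ord x"
      using pow_mod_ord[OF assms, of k] assms by simp
    then show ?thesis using ord_pos[OF assms] by (auto intro!: image_eqI[of _ _ "ord x"])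
  next
    case False
    then show ?thesis
      using pow_mod_ord[OF assms, of k] mod_less_divisor[OF ord_pos[OF assms], of k]
      by (intro image_eqI[of _ _ "k mod ord x"]) auto
  qed
  then show ?thesis using generate_pow_on_finite_carrier[OF finite_carrier assms] by auto
qed

lemma in_generate_iff:
  assumes "x \<in> carrier G"
  shows "y \<in> generate G {x} \<longleftrightarrow> (\<exists>i::nat. y = x [^] i)"
  using generate_pow_on_finite_carrier[OF finite_carrier assms] by auto

lemma subgroup_generate: "x \<in> carrier G \<Longrightarrow> subgroup (generate G {x}) G"
  by (rule generate_is_subgroup) simp

lemma generate_subset:
  assumes "subgroup H G" "x \<in> H"
  shows "generate G {x} \<subseteq> H"
  using generate_subgroup_incl[of "{x}" H] assms by simp

lemma generate_carrier: "x \<in> carrier G \<Longrightarrow> y \<in> generate G {x} \<Longrightarrow> y \<in> carrier G"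
  using generate_in_carrier[of "{x}" y] by simp

lemma card_generate: "x \<in> carrier G \<Longrightarrow> card (generate G {x}) = ord x"
  by (simp add: generate_pow_card)

lemma generate_commute:
  assumes "x \<in> carrier G" "y \<in> generate G {x}" "z \<in> generate G {x}"
  shows "y \<otimes> z = z \<otimes> y"
  using assms by (auto simp: in_generate_iff nat_pow_mult add.commute)

text \<open>The power \<open>x [^] k\<close> has order n / gcd(k, n); grouping exponents by their
  gcd with n produces the totients.\<close>

lemma sum_ord_generate:
  assumes "x \<in> carrier G"
  shows "(\<Sum>g\<in>generate G {x}. ord g) = cyclic_psi (ord x)"
proof -
  define n where "n = ord x"
  have n: "n > 0" using ord_pos[OF assms] by (simp add: n_def)
  have "(\<Sum>g\<in>generate G {x}. ord g) = (\<Sum>i\<in>{1..n}. ord (x [^] i))"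
    unfolding generate_eq_image[OF assms] n_def
    using ord_inj'[OF assms] by (subst sum.reindex) (auto simp: o_def)
  also have "\<dots> = (\<Sum>k\<in>{1..n}. n div gcd k n)"
    by (intro sum.cong) (auto simp: ord_pow_gen assms n_def gcd.commute)
  also have "\<dots> = (\<Sum>d\<in>{d. d dvd n}. \<Sum>k\<in>{k \<in> {1..n}. gcd k n = d}. n div gcd k n)"
    using n by (intro sum.group[symmetric]) auto
  also have "\<dots> = (\<Sum>d\<in>{d. d dvd n}. (n div d) * totient (n div d))"
  proof (intro sum.cong refl)
    fix d assume "d \<in> {d. d dvd n}"
    then have "card {k \<in> {1..n}. gcd k n = d} = totient (n div d)"
      using card_gcd_eq_totient[of n d] n by (simp add: greaterThanAtMost_def atLeastAtMost_def Suc_le_eq atLeast_def greaterThan_def)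
    then show "(\<Sum>k\<in>{k \<in> {1..n}. gcd k n = d}. n div gcd k n) = (n div d) * totient (n div d)"
      by simp
  qed
  also have "\<dots> = cyclic_psi n"
    unfolding cyclic_psi_def using n
    by (intro sum.reindex_bij_witness[of _ "(div) n" "(div) n"]) (auto elim: dvdE)
  finally show ?thesis by (simp add: n_def)
qed

lemma pow_gcd_in_generate:
  assumes "x \<in> carrier G"
  shows "x [^] gcd k (ord x) \<in> generate G {x [^] k}"
proof (cases "k = 0")
  case True
  then show ?thesis using assms by (simp add: generate.one)
next
  case False
  then obtain a where "[k * a = gcd k (ord x)] (mod ord x)" using cong_solve_nat[of k "ord x"] by auto
  then have "x [^] (k * a) = x [^] gcd k (ord x)"
    using pow_mod_ord[OF assms, of "k * a"] pow_mod_ord[OF assms, of "gcd k (ord x)"]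
    by (simp add: cong_def)
  then show ?thesis using assms by (auto simp: in_generate_iff nat_pow_pow intro!: exI[of _ a])
qed

lemma in_generate_pow_coprime:
  assumes "x \<in> carrier G" "coprime k (ord x)"
  shows "x \<in> generate G {x [^] k}"
  using pow_gcd_in_generate[OF assms(1), of k] assms by simp

text \<open>A cyclic group has only one subgroup of each order. Typical use: once a conjugate of
  \<open>y\<close> is known to lie in the cyclic group around \<open>y\<close>, equality of orders
  puts it into the subgroup generated by \<open>y\<close>.\<close>

lemma in_generate_if_ord_dvd:
  assumes "x \<in> carrier G" "y \<in> generate G {x}" "w \<in> generate G {x}" "ord w dvd ord y"
  shows "w \<in> generate G {y}"
proof -
  define n where "n = ord x"
  have n: "n > 0" using ord_pos[OF assms(1)] by (simp add: n_def)
  obtain i :: nat where i: "w = x [^] i" "i > 0"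
    using assms(3) unfolding generate_eq_image[OF assms(1)] using that by auto
  obtain j :: nat where j: "y = x [^] j" "j > 0"
    using assms(2) unfolding generate_eq_image[OF assms(1)] using that by auto
  have "n div gcd n i dvd n div gcd n j"
    using assms(4) i j assms(1) by (simp add: ord_pow_gen n_def)
  then obtain t where t: "n div gcd n j = (n div gcd n i) * t" by (elim dvdE)
  have "(n div gcd n i) * gcd n i = (n div gcd n j) * gcd n j" by simp
  also have "\<dots> = (n div gcd n i) * (t * gcd n j)" by (simp only: t mult.assoc)
  finally have "(n div gcd n i) * gcd n i = (n div gcd n i) * (t * gcd n j)" .
  moreover have "n div gcd n i \<noteq> 0"
    using n by (metis dvd_mult_div_cancel gcd_dvd1 mult_0_right less_irrefl)
  ultimately have "gcd n i = t * gcd n j" using mult_left_cancel by blast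
  then have "gcd n j dvd i" by (metis dvd_triv_right dvd_trans gcd_dvd2)
  then obtain s where "i = gcd j n * s" by (auto simp: gcd.commute)
  then have "w = (x [^] gcd j n) [^] s" using assms(1) i by (simp add: nat_pow_pow)
  moreover obtain r :: nat where "x [^] gcd j n = y [^] r"
    using pow_gcd_in_generate[OF assms(1), of j] j assms(1) by (auto simp: n_def in_generate_iff)
  ultimately have "w = y [^] (r * s)" using j assms(1) by (simp add: nat_pow_pow mult.assoc)
  then show ?thesis using j assms(1) by (auto simp: in_generate_iff)
qed

lemma conj_pow:
  assumes "g \<in> carrier G" "x \<in> carrier G"
  shows "(g \<otimes> x \<otimes> inv g) [^] (n::nat) = g \<otimes> x [^] n \<otimes> inv g"
proof (induction n)
  case (Suc n)
  have "(g \<otimes> x \<otimes> inv g) [^] Suc n = g \<otimes> x [^] n \<otimes> inv g \<otimes> (g \<otimes> x \<otimes> inv g)"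
    by (simp add: Suc)
  also have "\<dots> = g \<otimes> x [^] n \<otimes> (inv g \<otimes> g) \<otimes> x \<otimes> inv g"
    using assms by (simp only: m_assoc m_closed inv_closed nat_pow_closed)
  finally show ?case using assms by (simp add: m_assoc)
qed (use assms in simp)

lemma conj_eq_one_iff:
  assumes "g \<in> carrier G" "x \<in> carrier G"
  shows "g \<otimes> x \<otimes> inv g = \<one> \<longleftrightarrow> x = \<one>"
  using assms by (metis inv_closed inv_solve_right' l_cancel_one m_closed one_closed r_one l_one)

lemma ord_conj:
  assumes "g \<in> carrier G" "x \<in> carrier G"
  shows "ord (g \<otimes> x \<otimes> inv g) = ord x"
  using assms by (simp add: ord_unique conj_pow conj_eq_one_iff pow_eq_id)

lemma normal_generate_singletonI:
  assumes "x \<in> carrier G" "\<And>g. g \<in> carrier G \<Longrightarrow> g \<otimes> x \<otimes> inv g \<in> generate G {x}"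
  shows "generate G {x} \<lhd> G"
  unfolding normal_inv_iff
proof (intro conjI ballI)
  fix g h assume g: "g \<in> carrier G" and "h \<in> generate G {x}"
  then obtain i :: nat where "h = x [^] i" using assms(1) by (auto simp: in_generate_iff)
  moreover obtain j :: nat where "g \<otimes> x \<otimes> inv g = x [^] j"
    using assms(2)[OF g] assms(1) by (auto simp: in_generate_iff)
  ultimately have "g \<otimes> h \<otimes> inv g = x [^] (j * i)"
    using conj_pow[OF g assms(1), of i] assms(1) by (simp add: nat_pow_pow)
  then show "g \<otimes> h \<otimes> inv g \<in> generate G {x}" using assms(1) by (auto simp: in_generate_iff)
qed (rule subgroup_generate[OF assms(1)])

text \<open>The strict inequality says that the index of \<open>C\<close> is at most
  \<open>t\<close>, while \<open>h\<close> supplies \<open>t + 1\<close> elements.\<close>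

lemma coset_pigeonhole:
  assumes "subgroup C G" "\<And>i. i \<le> t \<Longrightarrow> h i \<in> carrier G" "order G < Suc t * card C"
  shows "\<exists>i j. i < j \<and> j \<le> t \<and> h j \<otimes> inv (h i) \<in> C"
proof -
  interpret C: subgroup C G by fact
  have "card (rcosets C) * card C < Suc t * card C"
    using lagrange[OF assms(1)] assms(3) by simp
  then have "card (rcosets C) < card {..t}" by (simp only: mult_less_cancel2 card_atMost)
  moreover have "(\<lambda>i. C #> h i) ` {..t} \<subseteq> rcosets C"
    using assms(2) by (auto intro!: rcosetsI C.subset)
  moreover have "finite (rcosets C)"
    using rcosets_subset_PowG[OF assms(1)] by (auto intro: finite_subset)
  ultimately have "\<not> inj_on (\<lambda>i. C #> h i) {..t}"
    by (meson card_inj_on_le leD)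
  then obtain i j where "i \<le> t" "j \<le> t" "i < j" "C #> h i = C #> h j"
    unfolding inj_on_def by (metis atMost_iff linorder_neqE_nat)
  then show ?thesis
    using assms(2) by (metis C.rcos_module is_group rcos_self assms(1))
qed

lemma order_quotient:
  assumes "N \<lhd> G"
  shows "order (G Mod N) * card N = order G"
  using lagrange[OF normal_imp_subgroup[OF assms]] by (simp add: order_def FactGroup_def)

lemma finite_group_quotient:
  assumes "N \<lhd> G"
  shows "finite_group (G Mod N)"
proof -
  have "finite (rcosets N)"
    using rcosets_subset_PowG[OF normal_imp_subgroup[OF assms]] by (auto intro: finite_subset)
  then have "finite (carrier (G Mod N))" by (simp add: FactGroup_def)
  then show ?thesis using normal.factorgroup_is_group[OF assms]
    by (simp add: finite_group_def finite_group_axioms_def)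
qed

lemma ord_quotient_dvd_iff:
  assumes "N \<lhd> G" "x \<in> carrier G"
  shows "group.ord (G Mod N) (N #> x) dvd k \<longleftrightarrow> x [^] k \<in> N"
proof -
  interpret N: normal N G by fact
  interpret Q: finite_group "G Mod N" using assms(1) by (rule finite_group_quotient)
  have "N #> x \<in> carrier (G Mod N)" using assms(2) by (auto simp: carrier_FactGroup)
  then have "Q.ord (N #> x) dvd k \<longleftrightarrow> N #> (x [^] k) = N"
    using assms(2) by (simp add: Q.pow_eq_id[symmetric] N.FactGroup_pow)
  then show ?thesis
    using assms(2) by (metis coset_join1 coset_join2 nat_pow_closed N.subgroup_axioms)
qed

lemma ord_dvd_ord_quotient:
  assumes "N \<lhd> G" "x \<in> carrier G"
  shows "ord x dvd group.ord (G Mod N) (N #> x) * card N"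
proof -
  interpret N: normal N G by fact
  define e where "e = group.ord (G Mod N) (N #> x)"
  have "x [^] e \<in> N" using ord_quotient_dvd_iff[OF assms, of e] by (simp add: e_def)
  then have "(x [^] e) [^] card N = \<one>"
    using group.pow_order_eq_1[OF subgroup_imp_group[OF N.subgroup_axioms], of "x [^] e"]
    by (simp add: order_def flip: nat_pow_consistent)
  then show ?thesis using assms(2) by (simp add: nat_pow_pow pow_eq_id e_def)
qed

lemma ord_dvd_card_subgroup:
  assumes "subgroup H G" "x \<in> H"
  shows "ord x dvd card H"
proof -
  have "x [^] card H = \<one>"
    using group.pow_order_eq_1[OF subgroup_imp_group[OF assms(1)], of x] assms(2)
    by (simp add: order_def flip: nat_pow_consistent)
  then show ?thesis using subgroup.mem_carrier[OF assms] by (simp add: pow_eq_id)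
qed

lemma card_subgroup_dvd:
  assumes "subgroup H G" "subgroup K G" "H \<subseteq> K"
  shows "card H dvd card K"
proof -
  have "subgroup H (G\<lparr>carrier := K\<rparr>)" using assms by (rule subgroup_incl)
  then show ?thesis
    using group.lagrange[OF subgroup_imp_group[OF assms(2)], of H] by (simp add: order_def) (metis dvd_triv_right)
qed

text \<open>The prime \<open>q\<close> is the product of the indices of \<open>C\<close> in
  \<open>M\<close> and of \<open>M\<close> in \<open>G\<close>; the first is not 1.\<close>

lemma prime_index_maximal:
  assumes "subgroup C G" "subgroup M G" "C \<subseteq> M" "M \<noteq> C"
    and "Factorial_Ring.prime q" "order G = q * card C"
  shows "M = carrier G"
proof -
  interpret M: subgroup M G by fact
  interpret C: subgroup C G by fact
  have fin: "finite M" using M.subset by (rule finite_subset) simp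
  obtain b where b: "card M = card C * b" using card_subgroup_dvd[OF assms(1-3)] by (elim dvdE)
  obtain a where a: "order G = card M * a"
    using lagrange[OF assms(2)] by (metis mult.commute)
  have "card C > 0" using order_pos assms(6) by (metis gr0I mult_0_right less_irrefl)
  then have "q = b * a" using a b assms(6) by (simp add: mult.left_commute mult.commute)
  moreover have "b \<noteq> 1" using b assms(3,4) fin card_subset_eq by (metis mult.right_neutral)
  ultimately have "a = 1" using assms(5) by (metis prime_product)
  then show ?thesis using a M.subset card_subset_eq[of "carrier G" M] by (simp add: order_def)
qed

lemma subgroup_centralizer:
  assumes "y \<in> carrier G"
  shows "subgroup {m \<in> carrier G. m \<otimes> y = y \<otimes> m} G"
proof (rule subgroupI)
  fix a b assume "a \<in> {m \<in> carrier G. m \<otimes> y = y \<otimes> m}"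
  then have a: "a \<in> carrier G" "a \<otimes> y = y \<otimes> a" by auto
  then show "inv a \<in> {m \<in> carrier G. m \<otimes> y = y \<otimes> m}"
    using assms by simp (metis inv_closed inv_solve_left' inv_solve_right m_assoc m_closed)
  assume "b \<in> {m \<in> carrier G. m \<otimes> y = y \<otimes> m}"
  then show "a \<otimes> b \<in> {m \<in> carrier G. m \<otimes> y = y \<otimes> m}"
    using assms a by simp (metis m_assoc)
qed (use assms in auto)

lemma carrier_eq_generate:
  assumes "x \<in> carrier G" "order G \<le> ord x"
  shows "carrier G = generate G {x}"
  using card_seteq[of "carrier G" "generate G {x}"] assms card_generate[of x] generate_carrier[of x]
  by (auto simp: order_def)

lemma cauchy:
  assumes "Factorial_Ring.prime q" "q dvd order G"
  obtains y where "y \<in> carrier G" "ord y = q"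
proof -
  \<comment> \<open>Sylow's theorem is applied with exponent 1, so \<open>m\<close> may still be
    divisible by \<open>q\<close>.\<close>
  obtain m where "order G = q ^ 1 * m" using assms(2) by auto
  then obtain H where H: "subgroup H G" "card H = q ^ 1"
    using sylow_thm[OF assms(1) is_group _ finite_carrier] by blast
  then have "card H > 1" using prime_gt_1_nat[OF assms(1)] by simp
  then obtain y where y: "y \<in> H" "y \<noteq> \<one>"
    by (metis One_nat_def card_le_Suc0_iff_eq card.infinite less_irrefl_nat not_less0 linorder_not_less)
  have yG: "y \<in> carrier G" using H y subgroup.mem_carrier by metis
  then have "ord y = q"
    using ord_dvd_card_subgroup[OF H(1) y(1)] y(2) H(2) assms(1) ord_eq_1[OF yG]
    by (metis power_one_right prime_nat_iff)
  with yG show ?thesis by (rule that)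
qed

end

section \<open>Groups with a cyclic subgroup of small index\<close>

context finite_group
begin

lemma supersolvable_if_ord_eq_order:
  assumes "x \<in> carrier G" "ord x = order G"
  shows "supersolvable G"
  using assms carrier_eq_generate[of x] by (intro supersolvable_cyclic[of x]) auto

lemma supersolvable_prime_order:
  assumes "Factorial_Ring.prime (order G)"
  shows "supersolvable G"
proof -
  obtain y where "y \<in> carrier G" "ord y = order G" using cauchy[OF assms] by auto
  then show ?thesis by (rule supersolvable_if_ord_eq_order)
qed

text \<open>Two distinct subgroups of order \<open>q\<close> would have a product of size \<open>q\<^sup>2\<close>, exceeding
  the order of the group; so the subgroup of order \<open>q\<close> is normal.\<close>

lemma supersolvable_small_cyclic_complement:
  assumes "Factorial_Ring.prime q" "order G = q * d" "d < q" "x \<in> carrier G" "ord x = d"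
  shows "supersolvable G"
proof -
  obtain y where y: "y \<in> carrier G" "ord y = q"
    using cauchy[OF assms(1)] assms(2) by auto
  have cop: "coprime k q" if "0 < k" "k < q" for k
    using that assms(1) by (metis coprime_commute nat_dvd_not_less prime_imp_coprime)
  have unique: "z \<in> generate G {y}" if z: "z \<in> carrier G" "ord z = q" for z
  proof -
    \<comment> \<open>The group generated by \<open>y\<close> has index \<open>d\<close>, so two of
      the \<open>d + 1\<close> powers of \<open>z\<close> from exponent 0 to \<open>d\<close> share
      a coset. Their exponents differ by less than \<open>q\<close>, so the difference is invertible
      modulo \<open>q\<close>.\<close>
    have "order G < Suc d * card (generate G {y})"
      using y assms(1,2) by (simp add: card_generate prime_gt_0_nat mult.commute)
    then obtain i j where ij: "i < j" "j \<le> d" "z [^] j \<otimes> inv (z [^] i) \<in> generate G {y}"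
      using coset_pigeonhole[OF subgroup_generate[OF y(1)], of d "\<lambda>i. z [^] i"] z(1) by auto
    have "z [^] j = z [^] (j - i) \<otimes> z [^] i" using ij z by (simp add: nat_pow_mult)
    then have "z [^] (j - i) \<in> generate G {y}" using ij z by (simp add: m_assoc)
    moreover have "coprime (j - i) (ord z)" using cop[of "j - i"] ij assms(3) z(2) by simp
    ultimately show ?thesis
      using in_generate_pow_coprime[OF z(1)] generate_subset[OF subgroup_generate[OF y(1)]] by blast
  qed
  define N where "N = generate G {y}"
  have normal: "N \<lhd> G" unfolding N_def
    using y by (intro normal_generate_singletonI unique) (auto simp: ord_conj)
  interpret Q: finite_group "G Mod N" using normal by (rule finite_group_quotient)
  have "order (G Mod N) * q = order G"
    using order_quotient[OF normal] y by (simp add: N_def card_generate)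
  then have orderQ: "order (G Mod N) = d" using assms(1,2) by (simp add: prime_gt_0_nat)
  define Y where "Y = N #> x"
  have Y: "Y \<in> carrier (G Mod N)" using assms(4) by (auto simp: Y_def carrier_FactGroup)
  have "0 < d" using orderQ Q.order_pos by simp
  \<comment> \<open>This element lies in \<open>N\<close>, of order \<open>q\<close>, and its order
    divides \<open>d\<close>, which is coprime to \<open>q\<close>. It is therefore trivial, and
    \<open>x\<close> keeps its order modulo \<open>N\<close>.\<close>
  have "x [^] Q.ord Y \<in> N" using ord_quotient_dvd_iff[OF normal assms(4), of "Q.ord Y"] by (simp add: Y_def)
  then have "ord (x [^] Q.ord Y) dvd q"
    using ord_dvd_card_subgroup[OF subgroup_generate[OF y(1)]] y by (simp add: N_def card_generate)
  moreover have "ord (x [^] Q.ord Y) dvd d"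
    using assms(4,5) pow_eq_id by (metis nat_pow_closed nat_pow_comm nat_pow_one nat_pow_pow dvd_refl mult.commute)
  moreover have "coprime d q" using cop \<open>0 < d\<close> assms(3) by simp
  ultimately have "ord (x [^] Q.ord Y) = 1"
    by (meson coprime_common_divisor_nat)
  then have "d dvd Q.ord Y" using assms(4,5) pow_eq_id[OF assms(4)] ord_eq_1 by (metis nat_pow_closed)
  moreover have "Q.ord Y dvd d" using orderQ Q.ord_dvd_group_order[OF Y] by simp
  ultimately have "Q.ord Y = order (G Mod N)" using orderQ dvd_antisym by metis
  then show ?thesis
    using supersolvable_quotient[OF normal y(1)] Q.supersolvable_if_ord_eq_order[OF Y] N_def by simp
qed

text \<open>If \<open>C = \<langle>x\<rangle>\<close> has prime index \<open>q\<close> and is not normal, then some \<open>x\<^sup>k\<close> with \<open>0 < k < q\<close> lies in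
  a conjugate of \<open>C\<close> other than \<open>C\<close>; it commutes with both, hence is central.\<close>

lemma supersolvable_cyclic_prime_index:
  assumes "Factorial_Ring.prime q" "x \<in> carrier G" "order G = q * ord x"
  shows "supersolvable G"
proof (cases "\<forall>g\<in>carrier G. g \<otimes> x \<otimes> inv g \<in> generate G {x}")
  case True
  then have normal: "generate G {x} \<lhd> G" using assms(2) by (intro normal_generate_singletonI) auto
  interpret Q: finite_group "G Mod generate G {x}" using normal by (rule finite_group_quotient)
  have "order (G Mod generate G {x}) * ord x = order G"
    using order_quotient[OF normal] assms(2) by (simp add: card_generate)
  then have "order (G Mod generate G {x}) = q" using assms(3) ord_pos[OF assms(2)] by simp
  then show ?thesis
    using supersolvable_quotient[OF normal assms(2) refl] Q.supersolvable_prime_order assms(1) by simp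
next
  case False
  then obtain g where g: "g \<in> carrier G" "g \<otimes> x \<otimes> inv g \<notin> generate G {x}" by auto
  define C where "C = generate G {x}"
  interpret C: subgroup C G unfolding C_def using assms(2) by (rule subgroup_generate)
  have cardC: "card C = ord x" using assms(2) by (simp add: C_def card_generate)
  have xC: "x [^] i \<in> C" for i :: nat using assms(2) by (auto simp: C_def in_generate_iff)
  have xC1: "x \<in> C" using xC[of 1] assms(2) by simp
  have gC: "g \<notin> C" using g xC1 C_def C.m_closed C.m_inv_closed by metis
  \<comment> \<open>These are \<open>q + 1\<close> elements against \<open>q\<close> cosets. The
    last one stands for \<open>C\<close> itself, and no \<open>g \<otimes> x [^] i\<close> lies in
    \<open>C\<close>, so the collision is between two of the others.\<close>
  define h where "h i = (if i < q then g \<otimes> x [^] i else \<one>)" for i :: nat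
  have "order G < Suc q * card C" using assms(3) cardC ord_pos[OF assms(2)] by simp
  moreover have "h i \<in> carrier G" for i using g(1) assms(2) by (simp add: h_def)
  ultimately obtain i j where ij: "i < j" "j \<le> q" "h j \<otimes> inv (h i) \<in> C"
    using coset_pigeonhole[OF C.subgroup_axioms, of q h] by auto
  have "j \<noteq> q"
  proof
    assume "j = q"
    then have "inv (g \<otimes> x [^] i) \<in> C" using ij g(1) assms(2) by (simp add: h_def)
    then have "g \<otimes> x [^] i \<in> C" using C.m_inv_closed g(1) assms(2) by fastforce
    then have "g \<otimes> x [^] i \<otimes> inv (x [^] i) \<in> C" using xC C.m_closed C.m_inv_closed by blast
    then show False using gC g(1) assms(2) by (simp add: m_assoc)
  qed
  define k where "k = j - i"
  have k: "0 < k" "k < q" using ij \<open>j \<noteq> q\<close> by (auto simp: k_def)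
  define y where "y = g \<otimes> x [^] k \<otimes> inv g"
  have "x [^] j = x [^] k \<otimes> x [^] i" using ij assms(2) by (simp add: nat_pow_mult k_def)
  moreover have "x [^] i \<otimes> (inv (x [^] i) \<otimes> inv g) = inv g"
    using g(1) assms(2) by (simp add: m_assoc[symmetric])
  ultimately have "h j \<otimes> inv (h i) = y"
    using ij \<open>j \<noteq> q\<close> g(1) assms(2) by (simp add: h_def y_def inv_mult_group m_assoc inv_solve_left)
  then have yC: "y \<in> C" using ij by simp
  have yG: "y \<in> carrier G" using yC by simp
  \<comment> \<open>The centralizer of \<open>y\<close> contains \<open>C\<close>, which is abelian,
    and the conjugate of \<open>x\<close> of which \<open>y\<close> is a power; \<open>C\<close>
    being maximal, it is the whole group.\<close>
  define M where "M = {m \<in> carrier G. m \<otimes> y = y \<otimes> m}"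
  have "M = carrier G"
  proof (rule prime_index_maximal[OF C.subgroup_axioms _ _ _ assms(1)])
    show "subgroup M G" unfolding M_def using yG by (rule subgroup_centralizer)
    show "C \<subseteq> M" using generate_commute[OF assms(2)] yC by (auto simp: M_def C_def)
    have "y = (g \<otimes> x \<otimes> inv g) [^] k" using conj_pow g(1) assms(2) by (simp add: y_def)
    then have "g \<otimes> x \<otimes> inv g \<in> M"
      using g(1) assms(2) nat_pow_mult[of "g \<otimes> x \<otimes> inv g" 1 k] by (simp add: M_def nat_pow_Suc2[symmetric])
    then show "M \<noteq> C" using g(2) C_def by auto
    show "order G = q * card C" using assms(3) cardC by simp
  qed
  then have central: "a \<otimes> y = y \<otimes> a" if "a \<in> carrier G" for a using that by (auto simp: M_def)
  have "y \<otimes> g = g \<otimes> x [^] k" using g(1) assms(2) by (simp add: y_def m_assoc)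
  then have "x [^] k = y" using central[OF g(1)] g(1) yG assms(2) by simp
  \<comment> \<open>Replacing \<open>k\<close> by its gcd with \<open>ord x\<close> keeps the
    generated subgroup central and makes its index in C exactly \<open>d\<close>. The quotient then
    has order \<open>q * d\<close> with \<open>d < q\<close>, which is the case already
    settled.\<close>
  define d where "d = gcd k (ord x)"
  have d: "0 < d" "d < q" "d dvd ord x"
    using k le_less_trans[OF gcd_le1_nat[of k "ord x"]] by (simp_all add: d_def)
  have "x [^] d \<in> generate G {y}"
    using pow_gcd_in_generate[OF assms(2), of k] \<open>x [^] k = y\<close> by (simp add: d_def)
  then obtain r :: nat where r: "x [^] d = y [^] r" using yG by (auto simp: in_generate_iff)
  define N where "N = generate G {x [^] d}"
  have normal: "N \<lhd> G" unfolding N_def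
  proof (rule normal_generate_singletonI)
    fix a assume a: "a \<in> carrier G"
    have "a \<otimes> y \<otimes> inv a = y" using central[OF a] a yG by (simp add: m_assoc)
    then have "a \<otimes> x [^] d \<otimes> inv a = x [^] d" using conj_pow[OF a yG, of r] r by simp
    then show "a \<otimes> x [^] d \<otimes> inv a \<in> generate G {x [^] d}" by (simp add: generate.incl)
  qed (use assms(2) in simp)
  interpret Q: finite_group "G Mod N" using normal by (rule finite_group_quotient)
  have cardN: "card N = ord x div d"
    using assms(2) d by (simp add: N_def card_generate ord_pow)
  then have cardN': "card N * d = ord x" using d by simp
  then have cardN0: "card N > 0" using ord_pos[OF assms(2)] by (metis gr0I less_irrefl mult_0)
  have "order (G Mod N) * card N = (q * d) * card N"
    using order_quotient[OF normal] assms(3) cardN' by (simp add: mult.commute mult.left_commute)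
  then have orderQ: "order (G Mod N) = q * d" using cardN0 by simp
  have Y: "N #> x \<in> carrier (G Mod N)" using assms(2) by (auto simp: carrier_FactGroup)
  have "Q.ord (N #> x) dvd d"
    using ord_quotient_dvd_iff[OF normal assms(2)] assms(2) by (simp add: N_def generate.incl)
  moreover have "d dvd Q.ord (N #> x)"
    using ord_dvd_ord_quotient[OF normal assms(2)] cardN' cardN0 by (metis dvd_mult_cancel2 mult.commute nat_mult_dvd_cancel1)
  ultimately have "Q.ord (N #> x) = d" by (rule dvd_antisym)
  then have "supersolvable (G Mod N)"
    using Q.supersolvable_small_cyclic_complement[OF assms(1) orderQ d(2) Y] by simp
  then show ?thesis using supersolvable_quotient[OF normal, of "x [^] d"] assms(2) N_def by simp
qed

lemma supersolvable_order_4: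
  assumes "order G = 4"
  shows "supersolvable G"
proof -
  have "card (carrier G) \<noteq> 1" using assms by (simp add: order_def)
  then obtain x where x: "x \<in> carrier G" "x \<noteq> \<one>"
    by (metis is_singletonI' is_singleton_altdef one_closed empty_iff)
  have "ord x dvd 2 ^ 2" using ord_dvd_group_order[OF x(1)] assms by simp
  then obtain i where i: "i \<le> 2" "ord x = 2 ^ i"
    by (metis divides_primepow_nat two_is_prime_nat)
  have "ord x \<noteq> 1" using x ord_eq_1 by simp
  then have "ord x = 2 \<or> ord x = 4" using i by (auto simp: le_Suc_eq numeral_eq_Suc)
  then show ?thesis
    using supersolvable_if_ord_eq_order[OF x(1)] supersolvable_cyclic_prime_index[of 2, OF _ x(1)] assms
    by auto
qed

text \<open>If all squares are trivial the group is abelian and a subgroup of order 2 can be divided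
  out; otherwise some element has order 4 or 8, hence index at most 2.\<close>

lemma supersolvable_order_8:
  assumes "order G = 8"
  shows "supersolvable G"
proof (cases "\<forall>x\<in>carrier G. x \<otimes> x = \<one>")
  case True
  have "card (carrier G) \<noteq> 1" using assms by (simp add: order_def)
  then obtain x where x: "x \<in> carrier G" "x \<noteq> \<one>"
    by (metis is_singletonI' is_singleton_altdef one_closed empty_iff)
  have inv: "inv a = a" if "a \<in> carrier G" for a using that True inv_equality by blast
  have comm: "a \<otimes> b = b \<otimes> a" if "a \<in> carrier G" "b \<in> carrier G" for a b
    using that inv[of "a \<otimes> b"] inv[of a] inv[of b] by (simp add: inv_mult_group)
  have normal: "generate G {x} \<lhd> G"
  proof (rule normal_generate_singletonI[OF x(1)])
    fix g assume "g \<in> carrier G"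
    then show "g \<otimes> x \<otimes> inv g \<in> generate G {x}"
      using x(1) comm[of g x] by (simp add: m_assoc generate.incl)
  qed
  interpret Q: finite_group "G Mod generate G {x}" using normal by (rule finite_group_quotient)
  have "ord x dvd 2" using True x(1) pow_eq_id[OF x(1), of 2] by (simp add: numeral_2_eq_2)
  moreover have "ord x \<noteq> 1" using x ord_eq_1 by simp
  ultimately have "ord x = 2" using prime_nat_iff two_is_prime_nat by blast
  then have "order (G Mod generate G {x}) = 4"
    using order_quotient[OF normal] assms x(1) by (simp add: card_generate)
  then show ?thesis
    using supersolvable_quotient[OF normal x(1) refl] Q.supersolvable_order_4 by simp
next
  case False
  then obtain x where x: "x \<in> carrier G" "x \<otimes> x \<noteq> \<one>" by auto
  have "ord x dvd 2 ^ 3" using ord_dvd_group_order[OF x(1)] assms by simp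
  then obtain i where i: "i \<le> 3" "ord x = 2 ^ i"
    by (metis divides_primepow_nat two_is_prime_nat)
  have "\<not> ord x dvd 2" using x pow_eq_id[OF x(1), of 2] by (simp add: numeral_2_eq_2)
  then have "i = 2 \<or> i = 3" using i by (auto simp: le_Suc_eq numeral_eq_Suc)
  then show ?thesis
    using supersolvable_if_ord_eq_order[OF x(1)] supersolvable_cyclic_prime_index[of 2, OF _ x(1)] assms i
    by auto
qed

end

section \<open>Order sums and quotients by cyclic Hall subgroups\<close>

lemma ord_inj_hom:
  assumes "group_hom G H h" "inj_on h (carrier G)" "x \<in> carrier G"
  shows "group.ord H (h x) = group.ord G x"
proof -
  interpret group_hom G H h by fact
  have "h x [^]\<^bsub>H\<^esub> n = \<one>\<^bsub>H\<^esub> \<longleftrightarrow> x [^]\<^bsub>G\<^esub> n = \<one>\<^bsub>G\<^esub>" for n :: nat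
    using assms(2,3) inj_on_one_iff by (metis G.nat_pow_closed hom_nat_pow hom_one)
  then show ?thesis using assms(3) by (simp add: H.ord_unique G.pow_eq_id)
qed

lemma psi_iso:
  assumes "group G" "group H" "G \<cong> H"
  shows "psi G = psi H"
proof -
  obtain h where h: "h \<in> iso G H" using assms(3) by (auto simp: is_iso_def)
  then have hom: "group_hom G H h" and inj: "inj_on h (carrier G)" and img: "carrier H = h ` carrier G"
    using assms by (auto simp: group_hom_def group_hom_axioms_def iso_def bij_betw_def)
  then have "psi H = (\<Sum>g\<in>carrier G. group.ord H (h g))"
    unfolding psi_def img using inj by (simp add: sum.reindex)
  then show ?thesis using ord_inj_hom[OF hom inj] by (simp add: psi_def)
qed

lemma order_iso: "G \<cong> H \<Longrightarrow> order G = order H"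
  by (simp add: iso_same_card order_def)

lemma finite_group_integer_mod_group: "n > 0 \<Longrightarrow> finite_group (integer_mod_group n)"
  by (simp add: finite_group_def finite_group_axioms_def carrier_integer_mod_group)

lemma order_integer_mod_group: "n > 0 \<Longrightarrow> order (integer_mod_group n) = n"
  by (simp add: order_def carrier_integer_mod_group)

text \<open>The residue \<open>1 mod int n\<close> instead of 1 covers \<open>n = 1\<close>, where
  the carrier is {0}.\<close>

lemma integer_mod_group_generator:
  assumes "n > 0"
  shows "1 mod int n \<in> carrier (integer_mod_group n)"
    and "group.ord (integer_mod_group n) (1 mod int n) = n"
proof -
  interpret group "integer_mod_group n" by simp
  show *: "1 mod int n \<in> carrier (integer_mod_group n)"
    using assms by (simp add: carrier_integer_mod_group)
  show "ord (1 mod int n) = n"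
    using assms unfolding ord_unique[OF *]
    by (simp add: mod_mult_right_eq zmod_int[symmetric] flip: int_dvd_int_iff of_nat_mod) 
       (metis dvd_eq_mod_eq_0 of_nat_mod of_nat_eq_0_iff)
qed

lemma (in finite_group) psi_cyclic:
  assumes "x \<in> carrier G" "ord x = order G"
  shows "psi G = cyclic_psi (order G)"
  using sum_ord_generate[OF assms(1)] carrier_eq_generate[OF assms(1)] assms(2) by (simp add: psi_def)

lemma psi_integer_mod_group:
  assumes "n > 0"
  shows "psi (integer_mod_group n) = cyclic_psi n"
  using finite_group.psi_cyclic[OF finite_group_integer_mod_group[OF assms]
      integer_mod_group_generator(1)[OF assms]]
    integer_mod_group_generator(2)[OF assms] order_integer_mod_group[OF assms] by simp

lemma (in finite_group) cyclic_iso_integer_mod_group: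
  assumes "x \<in> carrier G" "ord x = order G"
  shows "integer_mod_group (order G) \<cong> G"
proof -
  define n where "n = order G"
  have n: "n > 0" using order_pos by (simp add: n_def)
  interpret Z: finite_group "integer_mod_group n" using n by (rule finite_group_integer_mod_group)
  have "(\<lambda>k. x [^] k) \<in> hom (integer_mod_group n) G"
  proof (rule homI)
    fix k l
    have "x [^] ((k + l) mod int n) = x [^] (k + l)"
      using assms by (simp add: int_pow_eq n_def mod_eq_dvd_iff[symmetric] dvd_minus_mod)
    then show "x [^] (k \<otimes>\<^bsub>integer_mod_group n\<^esub> l) = x [^] k \<otimes> x [^] l"
      using assms(1) by (simp add: int_pow_mult)
  qed (use assms in simp)
  then interpret f: group_hom "integer_mod_group n" G "\<lambda>k. x [^] k"
    by (simp add: group_hom_def group_hom_axioms_def)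
  have "inj_on (\<lambda>k::int. x [^] k) (carrier (integer_mod_group n))"
    unfolding f.inj_on_one_iff using assms n
    by (auto simp: int_pow_eq_id n_def carrier_integer_mod_group zdvd_not_zless dest: zdvd_imp_le)
  moreover have "card (carrier (integer_mod_group n)) = card (carrier G)"
    using order_integer_mod_group[OF n] by (simp add: order_def n_def)
  ultimately have "(\<lambda>k::int. x [^] k) ` carrier (integer_mod_group n) = carrier G"
    by (metis card_image card_subset_eq f.hom_closed finite_carrier image_subsetI)
  then show ?thesis
    using \<open>inj_on _ _\<close> f.homh by (auto simp: is_iso_def iso_def bij_betw_def n_def)
qed

text \<open>An induction stays within one type, but a quotient lives on sets of elements. Copying
  finite groups to the natural numbers allows quotients to re-enter the induction.\<close>

lemma (in finite_group) iso_nat_group: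
  obtains H :: "nat monoid" where "group H" "G \<cong> H"
proof -
  obtain h :: "'a \<Rightarrow> nat" and n where h: "inj_on h (carrier G)"
    using finite_imp_inj_to_nat_seg[OF finite_carrier] by auto
  define H where "H = \<lparr>carrier = h ` carrier G,
    monoid.mult = (\<lambda>a b. h (inv_into (carrier G) h a \<otimes> inv_into (carrier G) h b)), one = h \<one>\<rparr>"
  have hom: "h \<in> hom G H" using h by (auto simp: hom_def H_def)
  then have "group (H\<lparr>carrier := h ` carrier G, one := h \<one>\<rparr>)" by (rule hom_imp_img_group)
  then have "group H" by (simp add: H_def)
  moreover have "G \<cong> H" using hom h by (auto simp: is_iso_def iso_def bij_betw_def H_def)
  ultimately show ?thesis by (rule that)
qed

context finite_group
begin

lemma finite_group_iso: "G \<cong> H \<Longrightarrow> group H \<Longrightarrow> finite_group H"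
  using iso_finite[of G H] by (simp add: finite_group_def finite_group_axioms_def)

lemma exists_large_ord: "\<exists>x\<in>carrier G. psi G \<le> order G * ord x"
proof -
  define m where "m = Max (ord ` carrier G)"
  have "m \<in> ord ` carrier G"
    unfolding m_def using one_closed by (intro Max_in) auto
  then obtain x where x: "x \<in> carrier G" "m = ord x" by auto
  have "psi G \<le> of_nat (card (carrier G)) * m"
    unfolding psi_def by (intro sum_bounded_above) (simp add: m_def)
  then show ?thesis using x by (auto simp: order_def)
qed

lemma coset_eq_iff:
  assumes "subgroup H G" "a \<in> carrier G" "b \<in> carrier G"
  shows "H #> a = H #> b \<longleftrightarrow> a \<otimes> inv b \<in> H"
  using assms by (metis repr_independence rcos_self subgroup.rcos_module is_group)

lemma coset_absorb:
  assumes "subgroup H G" "u \<in> H" "x \<in> carrier G"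
  shows "H #> (u \<otimes> x) = H #> x"
  using assms coset_eq_iff[OF assms(1), of "u \<otimes> x" x] subgroup.mem_carrier[OF assms(1,2)]
  by (simp add: m_assoc)

text \<open>Take the power of \<open>g\<close> with exponent \<open>card P * a\<close>, congruent to
  1 modulo the order \<open>d\<close> of the coset: the coset is unchanged, while the factor
  \<open>card P\<close> kills \<open>g [^] d\<close>, which lies in \<open>P\<close>.\<close>

lemma coset_representative:
  assumes "P \<lhd> G" "coprime (card P) (order (G Mod P))" "g \<in> carrier G"
  obtains x where "x \<in> carrier G" "P #> x = P #> g"
    "x [^] group.ord (G Mod P) (P #> g) = \<one>"
proof -
  interpret P: normal P G by fact
  interpret Q: finite_group "G Mod P" using assms(1) by (rule finite_group_quotient)
  define d where "d = Q.ord (P #> g)"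
  have Y: "P #> g \<in> carrier (G Mod P)" using assms(3) by (auto simp: carrier_FactGroup)
  have "d dvd order (G Mod P)" using Q.ord_dvd_group_order[OF Y] by (simp add: d_def)
  then have "coprime (card P) d" using assms(2) by (metis coprime_divisors dvd_refl)
  then obtain a where a: "[card P * a = 1] (mod d)" using cong_solve_coprime_nat by auto
  define x where "x = g [^] (card P * a)"
  have x: "x \<in> carrier G" using assms(3) by (simp add: x_def)
  have "P #> x = (P #> g) [^]\<^bsub>G Mod P\<^esub> (card P * a)"
    using P.FactGroup_pow[OF assms(3)] by (simp add: x_def)
  also have "\<dots> = (P #> g) [^]\<^bsub>G Mod P\<^esub> (1::nat)"
    using a Q.pow_mod_ord[OF Y, of "card P * a"] Q.pow_mod_ord[OF Y, of 1] by (simp add: cong_def d_def)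
  also have "\<dots> = P #> g" using Y by (simp only: Q.nat_pow_eone)
  finally have "P #> x = P #> g" .
  moreover have "x [^] d = \<one>"
  proof -
    have "g [^] d \<in> P" using ord_quotient_dvd_iff[OF assms(1,3), of d] by (simp add: d_def)
    then have "ord (g [^] d) dvd card P * a"
      using ord_dvd_card_subgroup[OF P.subgroup_axioms] by (simp add: dvd_mult2)
    then have "(g [^] d) [^] (card P * a) = \<one>" using assms(3) by (simp add: pow_eq_id)
    then show ?thesis using assms(3) by (simp add: x_def nat_pow_pow mult.commute)
  qed
  ultimately show ?thesis using x that by (simp add: d_def)
qed

text \<open>Subgroups of a cyclic group are determined by their order, hence preserved by
  conjugation.\<close>

lemma normal_sub_cyclic:
  assumes "generate G {y} \<lhd> G" "y \<in> carrier G" "u \<in> generate G {y}"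
  shows "generate G {u} \<lhd> G"
proof -
  interpret P: normal "generate G {y}" G by fact
  have u: "u \<in> carrier G" using assms(3) by simp
  show ?thesis
  proof (rule normal_generate_singletonI[OF u])
    fix g assume g: "g \<in> carrier G"
    then show "g \<otimes> u \<otimes> inv g \<in> generate G {u}"
      using in_generate_if_ord_dvd[OF assms(2,3) P.inv_op_closed2[OF g assms(3)]] ord_conj[OF g u] by simp
  qed
qed

text \<open>Modulo the normal subgroup generated by \<open>u\<close>, the elements
  \<open>u \<otimes> x\<close> and \<open>x\<close> agree, so the \<open>d\<close>-th power of
  \<open>u \<otimes> x\<close> falls into that subgroup.\<close>

lemma ord_coset_le:
  assumes "generate G {y} \<lhd> G" "y \<in> carrier G" "u \<in> generate G {y}"
    and "x \<in> carrier G" "x [^] d = \<one>"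
  shows "ord (u \<otimes> x) dvd d * ord u"
proof -
  define N where "N = generate G {u}"
  have N: "N \<lhd> G" unfolding N_def by (rule normal_sub_cyclic[OF assms(1-3)])
  interpret N: normal N G by fact
  have u: "u \<in> carrier G" using assms(2,3) generate_carrier by metis
  have "N #> (u \<otimes> x) = N #> x"
    using assms(4) by (intro coset_absorb[OF N.subgroup_axioms]) (auto simp: N_def generate.incl)
  then have "(u \<otimes> x) [^] d \<in> N"
    using ord_quotient_dvd_iff[OF N, of x d] ord_quotient_dvd_iff[OF N, of "u \<otimes> x" d] u assms(4,5)
    by simp
  then have "ord ((u \<otimes> x) [^] d) dvd ord u"
    using ord_dvd_card_subgroup[OF N.subgroup_axioms] u by (simp add: N_def card_generate)
  then show ?thesis
    using u assms(4) by (simp add: nat_pow_pow flip: pow_eq_id)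
qed

lemma sum_coset:
  assumes "P \<subseteq> carrier G" "x \<in> carrier G"
  shows "(\<Sum>g\<in>P #> x. f g) = (\<Sum>u\<in>P. f (u \<otimes> x))"
proof -
  have "P #> x = (\<lambda>u. u \<otimes> x) ` P" by (auto simp: r_coset_def)
  then show ?thesis using inj_on_g[OF assms] by (simp add: sum.reindex)
qed

lemma sum_over_cosets:
  assumes "subgroup P G"
  shows "(\<Sum>g\<in>carrier G. f g) = (\<Sum>Y\<in>rcosets P. \<Sum>g\<in>Y. f g)"
proof -
  have "sum f (\<Union>(rcosets P)) = (\<Sum>Y\<in>rcosets P. \<Sum>g\<in>Y. f g)"
    using rcos_disjoint[OF assms] cosets_finite[OF _ subgroup.subset[OF assms]]
    by (subst sum.Union_disjoint) (auto simp: pairwise_def disjnt_def)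
  then show ?thesis by (simp add: rcosets_part_G[OF assms])
qed

text \<open>In the equality case \<open>u x\<close> has order \<open>d |P|\<close> for a generator \<open>u\<close> of \<open>P\<close>; then
  \<open>(u x)\<^sup>d\<close> generates \<open>P\<close> and commutes with \<open>u x\<close>.\<close>

lemma psi_normal_cyclic:
  assumes normal: "P \<lhd> G" and y: "y \<in> carrier G" "P = generate G {y}"
    and cop: "coprime (card P) (order (G Mod P))"
  shows "psi G \<le> cyclic_psi (card P) * psi (G Mod P)"
    and "psi G = cyclic_psi (card P) * psi (G Mod P) \<Longrightarrow> u \<in> P \<Longrightarrow> g \<in> carrier G \<Longrightarrow> u \<otimes> g = g \<otimes> u"
proof -
  interpret P: normal P G by fact
  interpret Q: finite_group "G Mod P" using normal by (rule finite_group_quotient)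
  have carQ: "carrier (G Mod P) = rcosets P" by (simp add: FactGroup_def)
  have PG: "P \<subseteq> carrier G" by (rule P.subset)
  have sumP: "(\<Sum>u\<in>P. ord u) = cyclic_psi (card P)"
    using sum_ord_generate[OF y(1)] y by (simp add: card_generate)
  have rhs: "cyclic_psi (card P) * psi (G Mod P) = (\<Sum>Y\<in>rcosets P. \<Sum>u\<in>P. Q.ord Y * ord u)"
    by (simp add: psi_def carQ sum_distrib_left[symmetric] sum_distrib_right[symmetric] sumP)
  have lhs: "psi G = (\<Sum>Y\<in>rcosets P. \<Sum>g\<in>Y. ord g)"
    unfolding psi_def by (rule sum_over_cosets[OF P.subgroup_axioms])
  have rep: "\<exists>x\<in>carrier G. Y = P #> x \<and> x [^] Q.ord Y = \<one>" if Y: "Y \<in> rcosets P" for Y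
  proof -
    obtain g where "g \<in> carrier G" "Y = P #> g" using Y by (auto simp: RCOSETS_def)
    then show ?thesis using coset_representative[OF normal cop] by metis
  qed
  have le: "ord (u \<otimes> x) \<le> Q.ord Y * ord u"
    if "u \<in> P" "x \<in> carrier G" "x [^] Q.ord Y = \<one>" "Y \<in> rcosets P" for u x Y
  proof -
    have "ord (u \<otimes> x) dvd Q.ord Y * ord u"
      using ord_coset_le[of y u x "Q.ord Y"] normal y that(1-3) by simp
    moreover have "Q.ord Y * ord u > 0"
      using Q.ord_pos[of Y] ord_pos[of u] that(1,4) PG carQ by auto
    ultimately show ?thesis by (rule dvd_imp_le)
  qed
  have coset_le: "(\<Sum>g\<in>Y. ord g) \<le> (\<Sum>u\<in>P. Q.ord Y * ord u)" if Y: "Y \<in> rcosets P" for Y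
  proof -
    obtain x where x: "x \<in> carrier G" "Y = P #> x" "x [^] Q.ord Y = \<one>" using rep[OF Y] by auto
    have "(\<Sum>g\<in>Y. ord g) = (\<Sum>u\<in>P. ord (u \<otimes> x))" using sum_coset[OF PG x(1)] x(2) by simp
    also have "\<dots> \<le> (\<Sum>u\<in>P. Q.ord Y * ord u)" using le[OF _ x(1,3) Y] by (rule sum_mono)
    finally show ?thesis .
  qed
  have finP: "finite P" using PG by (rule finite_subset) simp
  have finQ: "finite (rcosets P)" using Q.finite_carrier carQ by simp
  show "psi G \<le> cyclic_psi (card P) * psi (G Mod P)"
    unfolding rhs lhs by (intro sum_mono coset_le)
  assume eq: "psi G = cyclic_psi (card P) * psi (G Mod P)" and u: "u \<in> P" and g: "g \<in> carrier G"
  define Y where "Y = P #> g"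
  have Y: "Y \<in> rcosets P" using g PG by (simp add: Y_def rcosetsI)
  obtain x where x: "x \<in> carrier G" "Y = P #> x" "x [^] Q.ord Y = \<one>" using rep[OF Y] by auto
  \<comment> \<open>Equal totals with termwise inequalities force equality on every coset, and then
    for every \<open>u\<close> in \<open>P\<close>, in particular for the generator
    \<open>y\<close>.\<close>
  have "(\<Sum>g\<in>Y. ord g) = (\<Sum>u\<in>P. Q.ord Y * ord u)"
    using sum_mono_inv[of "\<lambda>Y. \<Sum>g\<in>Y. ord g" "rcosets P" "\<lambda>Y. \<Sum>u\<in>P. Q.ord Y * ord u"] eq coset_le Y finQ
    unfolding rhs lhs by blast
  then have "(\<Sum>u\<in>P. ord (u \<otimes> x)) = (\<Sum>u\<in>P. Q.ord Y * ord u)"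
    using sum_coset[OF PG x(1), of ord] x(2) by metis
  then have ord_eq: "ord (y \<otimes> x) = Q.ord Y * ord y"
    using sum_mono_inv[of "\<lambda>u. ord (u \<otimes> x)" P "\<lambda>u. Q.ord Y * ord u" y] le[OF _ x(1,3) Y] finP y
    by (simp add: generate.incl)
  define z where "z = y \<otimes> x"
  have z: "z \<in> carrier G" using x y by (simp add: z_def)
  define w where "w = z [^] Q.ord Y"
  have "P #> z = Y"
    using x y coset_absorb[OF P.subgroup_axioms, of y x] by (simp add: z_def generate.incl)
  then have "w \<in> P" using ord_quotient_dvd_iff[OF normal z, of "Q.ord Y"] by (simp add: w_def)
  moreover have "ord w = ord y"
    using ord_eq ord_pow[OF z, of "Q.ord Y"] Q.ord_pos[of Y] Y by (simp add: w_def z_def carQ)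
  moreover have "y \<in> generate G {y}" by (simp add: generate.incl)
  ultimately have "y \<in> generate G {w}"
    using in_generate_if_ord_dvd[OF y(1), of w y] y(2) by (metis dvd_refl)
  then obtain i :: nat where "y = z [^] (Q.ord Y * i)"
    using z by (auto simp: w_def in_generate_iff nat_pow_pow)
  then have "y \<in> generate G {z}" using z by (auto simp: in_generate_iff)
  moreover have "z \<in> generate G {z}" by (simp add: generate.incl)
  ultimately have zy: "z \<otimes> y = y \<otimes> z" using generate_commute[OF z, of z y] by blast
  \<comment> \<open>The centralizer of \<open>y\<close> contains \<open>P\<close> and
    \<open>z\<close>, hence the whole coset in which \<open>g\<close> lies.\<close>
  define M where "M = {m \<in> carrier G. m \<otimes> y = y \<otimes> m}"
  interpret M: subgroup M G unfolding M_def using y(1) by (rule subgroup_centralizer)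
  have yP: "y \<in> P" unfolding y(2) by (simp add: generate.incl)
  have "P \<subseteq> M"
  proof
    fix u assume u: "u \<in> P"
    then have "u \<otimes> y = y \<otimes> u" using generate_commute[OF y(1), of u y] yP y(2) by metis
    then show "u \<in> M" using u PG unfolding M_def by blast
  qed
  moreover have "z \<in> M" using z zy unfolding M_def by blast
  moreover have "g \<otimes> inv z \<in> P"
    using \<open>P #> z = Y\<close> coset_eq_iff[OF P.subgroup_axioms g z] by (simp add: Y_def)
  ultimately have "(g \<otimes> inv z) \<otimes> z \<in> M" using M.m_closed by blast
  moreover have "(g \<otimes> inv z) \<otimes> z = g" using g z by (simp add: m_assoc)
  ultimately have gM: "g \<otimes> y = y \<otimes> g" unfolding M_def by simp
  \<comment> \<open>The same argument with roles exchanged: the centralizer of \<open>g\<close>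
    contains \<open>y\<close>, hence all of \<open>P\<close>.\<close>
  define L where "L = {m \<in> carrier G. m \<otimes> g = g \<otimes> m}"
  have "y \<in> L" using y(1) gM[symmetric] unfolding L_def by blast
  moreover have "subgroup L G" unfolding L_def using g by (rule subgroup_centralizer)
  ultimately have "u \<in> L" using generate_subset u y(2) by blast
  then show "u \<otimes> g = g \<otimes> u" unfolding L_def by blast
qed

end

section \<open>Splitting off a central Hall subgroup\<close>

context finite_group
begin

text \<open>The transfer to a central subgroup \<open>P\<close> restricts to \<open>P\<close> as the power map with exponent
  the index, which is bijective on \<open>P\<close> when the index is coprime to \<open>|P|\<close>.\<close>

lemma central_hall_subgroup_splits:
  assumes sub: "subgroup P G"
    and central: "\<And>u g. u \<in> P \<Longrightarrow> g \<in> carrier G \<Longrightarrow> u \<otimes> g = g \<otimes> u"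
    and cop: "coprime (card P) (order (G Mod P))"
  shows "G \<cong> (G\<lparr>carrier := P\<rparr>) \<times>\<times> (G Mod P)"
proof -
  interpret P: subgroup P G by fact
  have normal: "P \<lhd> G"
    using sub central unfolding normal_inv_iff by (metis P.mem_carrier inv_closed m_assoc r_inv r_one)
  interpret PN: normal P G by fact
  interpret Q: finite_group "G Mod P" using normal by (rule finite_group_quotient)
  interpret H: comm_group "G\<lparr>carrier := P\<rparr>"
    using subgroup_imp_group[OF sub] by (rule group.group_comm_groupI) (simp add: central)
  define R where "R = rcosets P"
  have finR: "finite R" using Q.finite_carrier by (simp add: R_def FactGroup_def)
  have cardR: "card R = order (G Mod P)" by (simp add: R_def FactGroup_def order_def)
  define s where "s Y = (SOME x. x \<in> Y)" for Y :: "'a set"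
  have sY: "s Y \<in> Y" if "Y \<in> R" for Y
    using that P.rcosets_non_empty some_in_eq by (auto simp: s_def R_def)
  have sG: "s Y \<in> carrier G" if "Y \<in> R" for Y
    using sY[OF that] that P.rcosets_carrier is_group by (auto simp: R_def)
  have sP: "P #> s Y = Y" if Y: "Y \<in> R" for Y
  proof -
    obtain a where a: "a \<in> carrier G" "Y = P #> a" using Y by (auto simp: R_def RCOSETS_def)
    then show ?thesis using repr_independence[OF _ a(1) sub, of "s Y"] sY[OF Y] by simp
  qed
  have shift: "Y #> g \<in> R" if "Y \<in> R" "g \<in> carrier G" for Y g
    using that P.subset by (auto simp: R_def RCOSETS_def coset_mult_assoc intro!: exI[of _ "_ \<otimes> _"])
  have shift_shift: "Y #> g #> h = Y #> (g \<otimes> h)"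
    if "Y \<in> R" "g \<in> carrier G" "h \<in> carrier G" for Y g h
    using that P.rcosets_carrier[OF is_group] by (simp add: R_def coset_mult_assoc)
  \<comment> \<open>The factor by which right multiplication by \<open>g\<close> moves the chosen
    representatives. It satisfies a cocycle identity, and its product \<open>V\<close> over all
    cosets is the transfer.\<close>
  define z where "z g Y = s Y \<otimes> g \<otimes> inv (s (Y #> g))" for g Y
  have zP: "z g Y \<in> P" if "g \<in> carrier G" "Y \<in> R" for g Y
  proof -
    have "P #> (s Y \<otimes> g) = P #> s (Y #> g)"
      using that sG sP shift P.subset by (simp add: coset_mult_assoc[symmetric])
    then show ?thesis using that sG shift by (simp add: z_def coset_eq_iff sub)
  qed
  define V where "V g = finprod (G\<lparr>carrier := P\<rparr>) (z g) R" for g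
  have V_mult: "V (g \<otimes> h) = V g \<otimes> V h" if g: "g \<in> carrier G" and h: "h \<in> carrier G" for g h
  proof -
    have "Y #> g #> inv g = Y" if "Y \<in> R" for Y
      using shift_shift[OF that g inv_closed[OF g]] that g P.rcosets_carrier[OF is_group]
      by (simp add: R_def)
    then have inj: "inj_on (\<lambda>Y. Y #> g) R" by (rule inj_on_inverseI)
    moreover have "(\<lambda>Y. Y #> g) ` R = R"
      using inj shift g by (intro card_subset_eq finR) (auto simp: card_image)
    \<comment> \<open>Multiplication by \<open>g\<close> permutes the cosets, which turns the
      cocycle identity into multiplicativity of \<open>V\<close>.\<close>
    ultimately have reindex: "V h = finprod (G\<lparr>carrier := P\<rparr>) (\<lambda>Y. z h (Y #> g)) R"
      using H.finprod_reindex[of "z h" "\<lambda>Y. Y #> g" R] zP h by (auto simp: V_def)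
    have "z (g \<otimes> h) Y = z g Y \<otimes> z h (Y #> g)" if "Y \<in> R" for Y
    proof -
      define a b c where "a = s Y" and "b = s (Y #> g)" and "c = s (Y #> g #> h)"
      have abc: "a \<in> carrier G" "b \<in> carrier G" "c \<in> carrier G"
        using that g h sG shift by (auto simp: a_def b_def c_def)
      have "a \<otimes> g \<otimes> inv b \<otimes> (b \<otimes> h \<otimes> inv c) = a \<otimes> g \<otimes> (inv b \<otimes> b) \<otimes> h \<otimes> inv c"
        using abc g h by (simp only: m_assoc m_closed inv_closed)
      also have "\<dots> = a \<otimes> (g \<otimes> h) \<otimes> inv c" using abc g h by (simp add: m_assoc)
      finally show ?thesis
        using shift_shift[OF that g h] by (simp add: z_def a_def b_def c_def)
    qed
    then have "V (g \<otimes> h) = finprod (G\<lparr>carrier := P\<rparr>) (\<lambda>Y. z g Y \<otimes> z h (Y #> g)) R"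
      using zP g h shift P.m_closed unfolding V_def by (intro H.finprod_cong') auto
    also have "\<dots> = V g \<otimes> V h"
      unfolding reindex V_def[of g]
      using H.finprod_multf[of "z g" R "\<lambda>Y. z h (Y #> g)"] zP g h shift by (simp add: Pi_def)
    finally show ?thesis .
  qed
  have V_P: "V u = u [^] card R" if u: "u \<in> P" for u
  proof -
    have "z u Y = u" if Y: "Y \<in> R" for Y
    proof -
      have "Y #> u = Y"
      proof -
        have "s Y \<otimes> u = u \<otimes> s Y" using central[OF u sG[OF Y]] by simp
        then have "P #> s Y #> u = P #> u #> s Y"
          using sG[OF Y] u P.subset by (simp add: coset_mult_assoc)
        also have "P #> u = P" using u sub by (simp add: coset_join2)
        finally show ?thesis using sP[OF Y] by simp
      qed
      then show ?thesis
        using central[OF u sG[OF Y]] sG[OF Y] u by (simp add: z_def m_assoc flip: central)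
    qed
    then have "V u = finprod (G\<lparr>carrier := P\<rparr>) (\<lambda>Y. u) R"
      unfolding V_def using u by (intro H.finprod_cong') auto
    also have "\<dots> = u [^] card R" using H.finprod_const[of u R] u by (simp flip: nat_pow_consistent)
    finally show ?thesis .
  qed
  have V_closed: "V g \<in> P" if "g \<in> carrier G" for g
    using H.finprod_closed[of "z g" R] zP that by (auto simp: V_def)
  define f where "f g = (V g, P #> g)" for g
  interpret D: group "(G\<lparr>carrier := P\<rparr>) \<times>\<times> (G Mod P)"
    using DirProd_group H.group_axioms Q.group_axioms by blast
  have "f \<in> hom G ((G\<lparr>carrier := P\<rparr>) \<times>\<times> (G Mod P))"
  proof (rule homI)
    show "f g \<in> carrier ((G\<lparr>carrier := P\<rparr>) \<times>\<times> (G Mod P))" if "g \<in> carrier G" for g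
      using that V_closed by (auto simp: f_def carrier_FactGroup)
    show "f (g \<otimes> h) = f g \<otimes>\<^bsub>(G\<lparr>carrier := P\<rparr>) \<times>\<times> (G Mod P)\<^esub> f h"
      if "g \<in> carrier G" "h \<in> carrier G" for g h
      using that V_mult PN.rcos_sum by (simp add: f_def)
  qed
  then interpret f: group_hom G "(G\<lparr>carrier := P\<rparr>) \<times>\<times> (G Mod P)" f
    by (simp add: group_hom_def group_hom_axioms_def D.group_axioms)
  \<comment> \<open>The second component puts a kernel element into \<open>P\<close>; the first
    makes its power with exponent the index trivial. Coprimality leaves only the identity.\<close>
  have inj: "inj_on f (carrier G)"
    unfolding f.inj_on_one_iff
  proof (intro allI impI)
    fix g assume g: "g \<in> carrier G" and "f g = \<one>\<^bsub>(G\<lparr>carrier := P\<rparr>) \<times>\<times> (G Mod P)\<^esub>"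
    then have "V g = \<one>" "P #> g = P" by (auto simp: f_def)
    then have gP: "g \<in> P" using coset_join1 g sub by blast
    then have "g [^] card R = \<one>" using V_P \<open>V g = \<one>\<close> by simp
    then have "ord g dvd card R" using g by (simp add: pow_eq_id)
    moreover have "ord g dvd card P" using ord_dvd_card_subgroup[OF sub gP] .
    ultimately have "ord g = 1" using cop cardR by (metis coprime_common_divisor_nat)
    then show "g = \<one>" using g ord_eq_1 by simp
  qed
  have "card (carrier ((G\<lparr>carrier := P\<rparr>) \<times>\<times> (G Mod P))) = card (carrier G)"
    using order_quotient[OF normal] by (simp add: card_cartesian_product order_def mult.commute)
  moreover have "finite (carrier ((G\<lparr>carrier := P\<rparr>) \<times>\<times> (G Mod P)))"
    using finite_subset[OF P.subset finite_carrier] Q.finite_carrier by simp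
  ultimately have "f ` carrier G = carrier ((G\<lparr>carrier := P\<rparr>) \<times>\<times> (G Mod P))"
    using inj by (intro card_subset_eq image_subsetI f.hom_closed) (simp_all add: card_image)
  then show ?thesis using inj f.homh by (auto simp: is_iso_def iso_def bij_betw_def)
qed

end

section \<open>Isomorphisms of direct products\<close>

lemma DirProd_cong:
  assumes "group G1" "group G2" "G1 \<cong> H1" "G2 \<cong> H2"
  shows "G1 \<times>\<times> G2 \<cong> H1 \<times>\<times> H2"
proof -
  obtain f g where f: "f \<in> iso G1 H1" "g \<in> iso G2 H2" using assms by (auto simp: is_iso_def)
  have "(\<lambda>(x, y). (f x, g y)) \<in> iso (G1 \<times>\<times> G2) (H1 \<times>\<times> H2)"
    using f assms by (simp add: iso_paired2)
  then show ?thesis by (rule is_isoI)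
qed

lemma DirProd_commute: "G \<times>\<times> H \<cong> H \<times>\<times> G"
  using DirProd_commute_iso_set[of G H] by (auto simp: is_iso_def)

lemma DirProd_assoc_iso: "(G \<times>\<times> H) \<times>\<times> I \<cong> G \<times>\<times> (H \<times>\<times> I)"
proof -
  have "(\<lambda>((x, y), z). (x, y, z)) \<in> iso ((G \<times>\<times> H) \<times>\<times> I) (G \<times>\<times> (H \<times>\<times> I))"
    by (auto simp: iso_def hom_def inj_on_def bij_betw_def DirProd_def image_iff)
  then show ?thesis by (rule is_isoI)
qed

lemma integer_mod_group_DirProd:
  assumes "m > 0" "n > 0" "coprime m n"
  shows "integer_mod_group (m * n) \<cong> integer_mod_group m \<times>\<times> integer_mod_group n"
proof -
  let ?D = "integer_mod_group m \<times>\<times> integer_mod_group n"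
  interpret m: group "integer_mod_group m" by simp
  interpret n: group "integer_mod_group n" by simp
  have D: "finite_group ?D"
    using assms finite_group.finite_carrier[OF finite_group_integer_mod_group]
    by (simp add: finite_group_def finite_group_axioms_def DirProd_group)
  interpret D: finite_group ?D by fact
  define x where "x = (1 mod int m, 1 mod int n)"
  have x: "x \<in> carrier ?D"
    using integer_mod_group_generator assms by (simp add: x_def)
  have pow: "(a, b) [^]\<^bsub>?D\<^esub> k = (a [^]\<^bsub>integer_mod_group m\<^esub> k, b [^]\<^bsub>integer_mod_group n\<^esub> k)" for a b and k :: nat
    by (induction k) auto
  have "x [^]\<^bsub>?D\<^esub> k = \<one>\<^bsub>?D\<^esub> \<longleftrightarrow> m dvd k \<and> n dvd k" for k :: nat
    using integer_mod_group_generator[OF assms(1)] integer_mod_group_generator[OF assms(2)]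
      m.pow_eq_id[of "1 mod int m" k] n.pow_eq_id[of "1 mod int n" k]
    unfolding x_def pow by (simp del: pow_integer_mod_group)
  also have "(m dvd k \<and> n dvd k) \<longleftrightarrow> m * n dvd k" for k
    using assms(3) by (auto intro: divides_mult dvd_trans)
  finally have "D.ord x = m * n" using D.ord_unique[OF x] by blast
  moreover have "order ?D = m * n"
    using assms order_integer_mod_group by (simp add: order_def card_cartesian_product)
  ultimately show ?thesis using D.cyclic_iso_integer_mod_group[OF x] by simp
qed

section \<open>Cyclic subgroups of index four\<close>

text \<open>Every element of the symmetric group on three points squares to the identity or is a
  3-cycle.\<close>

lemma three_points_permutation:
  assumes "card W = 3" "f \<in> W \<rightarrow> W" "inj_on f W"
  shows "(\<forall>a\<in>W. f (f a) = a) \<or>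
    (\<forall>a\<in>W. f a \<noteq> a \<and> f (f a) \<noteq> a \<and> f (f (f a)) = a \<and> W = {a, f a, f (f a)})"
proof -
  obtain a b c where W: "W = {a, b, c}" "a \<noteq> b" "a \<noteq> c" "b \<noteq> c"
    using assms(1) by (auto simp: card_3_iff)
  then have "f a \<in> {a, b, c}" "f b \<in> {a, b, c}" "f c \<in> {a, b, c}"
    "f a \<noteq> f b" "f a \<noteq> f c" "f b \<noteq> f c"
    using assms(2,3) by (auto simp: inj_on_def)
  then show ?thesis using W by (elim insertE emptyE) (simp_all, auto)
qed

context finite_group
begin

text \<open>Right multiplication by \<open>x\<close> permutes the three cosets other than
  \<open>C\<close>, and \<open>x [^] i\<close> fixes the coset of \<open>g\<close> exactly when
  \<open>g \<otimes> x [^] i \<otimes> inv g\<close> lies in \<open>C\<close>. The alternatives are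
  those of \<open>three_points_permutation\<close>.\<close>

lemma index_four_cases:
  assumes x: "x \<in> carrier G" and index: "order G = 4 * ord x" and C: "C = generate G {x}"
  shows "(\<forall>g\<in>carrier G. g \<otimes> x [^] (2::nat) \<otimes> inv g \<in> C) \<or>
    (\<forall>g\<in>carrier G - C. g \<otimes> x \<otimes> inv g \<notin> C \<and> g \<otimes> x [^] (2::nat) \<otimes> inv g \<notin> C \<and>
      g \<otimes> x [^] (3::nat) \<otimes> inv g \<in> C \<and>
      (\<forall>h\<in>carrier G - C. \<exists>i<3::nat. h \<otimes> inv (g \<otimes> x [^] i) \<in> C))"
proof -
  interpret C: subgroup C G unfolding C using x by (rule subgroup_generate)
  have xC: "x [^] i \<in> C" for i :: nat using x by (auto simp: C in_generate_iff)
  define W where "W = rcosets C - {C}"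
  define f where "f Y = Y #> x" for Y
  have "card (rcosets C) * card C = 4 * card C"
    using lagrange[OF C.subgroup_axioms] index x by (simp add: C card_generate)
  then have "card (rcosets C) = 4" using ord_pos[OF x] x by (simp add: C card_generate)
  moreover have "C \<in> rcosets C" by (rule C.subgroup_in_rcosets[OF is_group])
  ultimately have cardW: "card W = 3" by (simp add: W_def)
  have inW: "C #> g \<in> W \<longleftrightarrow> g \<notin> C" if "g \<in> carrier G" for g
    using that coset_join1[OF _ that C.subgroup_axioms] coset_join2[OF that C.subgroup_axioms]
    by (auto simp: W_def rcosetsI C.subset)
  have f_pow: "(f ^^ i) (C #> g) = C #> (g \<otimes> x [^] i)" if "g \<in> carrier G" for g i
    using that x by (induction i) (simp_all add: f_def coset_mult_assoc C.subset m_assoc)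
  have Wcases: "\<exists>g\<in>carrier G - C. Y = C #> g" if Y: "Y \<in> W" for Y
  proof -
    obtain g where "g \<in> carrier G" "Y = C #> g" using Y by (auto simp: W_def RCOSETS_def)
    then show ?thesis using inW Y by auto
  qed
  have "f \<in> W \<rightarrow> W"
  proof
    fix Y assume "Y \<in> W"
    then obtain g where g: "g \<in> carrier G" "g \<notin> C" "Y = C #> g" using Wcases by auto
    have "g \<otimes> x \<notin> C"
    proof
      assume "g \<otimes> x \<in> C"
      then have "(g \<otimes> x) \<otimes> inv x \<in> C" using xC[of 1] x by simp
      then show False using g x by (simp add: m_assoc)
    qed
    then show "f Y \<in> W" using inW[of "g \<otimes> x"] g x f_pow[OF g(1), of 1] by simp
  qed
  moreover have "inj_on f W"
  proof (rule inj_on_inverseI[where g = "\<lambda>Y. Y #> inv x"])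
    fix Y assume "Y \<in> W"
    then obtain g where g: "g \<in> carrier G" "Y = C #> g" using Wcases by auto
    moreover have "C #> g #> x #> inv x = C #> (g \<otimes> x \<otimes> inv x)"
      using g(1) x C.subset by (simp only: coset_mult_assoc m_closed inv_closed)
    moreover have "g \<otimes> x \<otimes> inv x = g" using g(1) x by (simp add: m_assoc)
    ultimately show "f Y #> inv x = Y" by (simp only: f_def)
  qed
  ultimately consider "\<forall>a\<in>W. f (f a) = a" |
    "\<forall>a\<in>W. f a \<noteq> a \<and> f (f a) \<noteq> a \<and> f (f (f a)) = a \<and> W = {a, f a, f (f a)}"
    using three_points_permutation[OF cardW, of f] by argo
  then show ?thesis
  proof cases
    case 1
    have "g \<otimes> x [^] (2::nat) \<otimes> inv g \<in> C" if g: "g \<in> carrier G" for g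
    proof (cases "g \<in> C")
      case True
      then show ?thesis using xC by simp
    next
      case False
      then have "(f ^^ 2) (C #> g) = C #> g" using 1 inW[OF g] by (simp add: numeral_2_eq_2)
      then show ?thesis using f_pow[OF g, of 2] g x by (simp add: coset_eq_iff C.subgroup_axioms)
    qed
    then show ?thesis by blast
  next
    case 2
    have "g \<otimes> x \<otimes> inv g \<notin> C \<and> g \<otimes> x [^] (2::nat) \<otimes> inv g \<notin> C \<and>
      g \<otimes> x [^] (3::nat) \<otimes> inv g \<in> C \<and>
      (\<forall>h\<in>carrier G - C. \<exists>i<3::nat. h \<otimes> inv (g \<otimes> x [^] i) \<in> C)" if g: "g \<in> carrier G - C" for g
    proof -
      have gG: "g \<in> carrier G" and "C #> g \<in> W" using g inW by auto
      then have f: "(f ^^ 1) (C #> g) \<noteq> C #> g" "(f ^^ 2) (C #> g) \<noteq> C #> g"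
        "(f ^^ 3) (C #> g) = C #> g"
        and W: "W = {(f ^^ 0) (C #> g), (f ^^ 1) (C #> g), (f ^^ 2) (C #> g)}"
        using 2 by (simp_all add: numeral_2_eq_2 numeral_3_eq_3)
      have "\<exists>i<3::nat. h \<otimes> inv (g \<otimes> x [^] i) \<in> C" if h: "h \<in> carrier G - C" for h
      proof -
        have "C #> h \<in> W" using h inW by auto
        then obtain i :: nat where "i < 3" "C #> h = (f ^^ i) (C #> g)" unfolding W
          by (metis (no_types, lifting) One_nat_def empty_iff insertE lessI less_Suc_eq numeral_2_eq_2 numeral_3_eq_3)
        then show ?thesis using f_pow[OF gG, of i] h gG x
          by (auto simp: coset_eq_iff C.subgroup_axioms)
      qed
      moreover have "C #> (g \<otimes> x [^] i) = C #> g \<longleftrightarrow> g \<otimes> x [^] i \<otimes> inv g \<in> C" for i :: nat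
        using gG x by (simp add: coset_eq_iff C.subgroup_axioms)
      ultimately show ?thesis using f f_pow[OF gG] x by (metis nat_pow_eone)
    qed
    then show ?thesis by blast
  qed
qed

text \<open>The subgroup generated by the square of \<open>x\<close> is then normal, being the only
  one of its order in the cyclic group. Its index is 4 times gcd(ord x, 2), so the quotient has
  order 4 or 8.\<close>

lemma supersolvable_index_four:
  assumes x: "x \<in> carrier G" and index: "order G = 4 * ord x"
    and core: "\<And>g. g \<in> carrier G \<Longrightarrow> g \<otimes> x [^] (2::nat) \<otimes> inv g \<in> generate G {x}"
  shows "supersolvable G"
proof -
  define y where "y = x [^] (2::nat)"
  define N where "N = generate G {y}"
  have y: "y \<in> carrier G" "y \<in> generate G {x}" using x by (auto simp: y_def in_generate_iff)
  have normal: "N \<lhd> G"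
    unfolding N_def
  proof (rule normal_generate_singletonI[OF y(1)])
    fix g assume g: "g \<in> carrier G"
    show "g \<otimes> y \<otimes> inv g \<in> generate G {y}"
      using in_generate_if_ord_dvd[OF x y(2) core[OF g, folded y_def]] ord_conj[OF g y(1)] by simp
  qed
  interpret Q: finite_group "G Mod N" using normal by (rule finite_group_quotient)
  define d where "d = gcd (ord x) 2"
  have "order (G Mod N) * ord y = order G"
    using order_quotient[OF normal] y by (simp add: N_def card_generate)
  moreover have "ord y * d = ord x"
    using x by (simp add: y_def ord_pow_gen d_def)
  ultimately have "order (G Mod N) * ord y = (4 * d) * ord y" using index by (simp add: ac_simps)
  then have "order (G Mod N) = 4 * d" using ord_pos[OF y(1)] by simp
  moreover have "d = 1 \<or> d = 2"
    using two_is_prime_nat unfolding d_def by (metis gcd_dvd2 prime_nat_iff)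
  ultimately have "supersolvable (G Mod N)"
    using Q.supersolvable_order_4 Q.supersolvable_order_8 by auto
  then show ?thesis using supersolvable_quotient[OF normal y(1)] N_def by simp
qed

lemma transversal:
  assumes "subgroup C G"
  obtains R where "R \<subseteq> carrier G" "card R * card C = order G"
    "\<And>g. g \<in> carrier G \<Longrightarrow> \<exists>r\<in>R. g \<otimes> inv r \<in> C"
    "\<And>r r'. r \<in> R \<Longrightarrow> r' \<in> R \<Longrightarrow> r \<otimes> inv r' \<in> C \<Longrightarrow> r = r'"
proof -
  define s where "s Y = (SOME x. x \<in> carrier G \<and> Y = C #> x)" for Y
  have s: "s Y \<in> carrier G \<and> Y = C #> s Y" if "Y \<in> rcosets C" for Y
    unfolding s_def using that by (intro someI_ex[of "\<lambda>x. x \<in> carrier G \<and> Y = C #> x"]) (auto simp: RCOSETS_def)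
  show ?thesis
  proof (rule that[of "s ` (rcosets C)"])
    show "s ` (rcosets C) \<subseteq> carrier G" using s by auto
    have "inj_on s (rcosets C)" using s by (metis inj_onI)
    then show "card (s ` (rcosets C)) * card C = order G"
      using lagrange[OF assms] by (simp add: card_image)
    show "\<exists>r\<in>s ` (rcosets C). g \<otimes> inv r \<in> C" if "g \<in> carrier G" for g
      using that s[of "C #> g"] coset_eq_iff[OF assms that] rcosetsI[OF subgroup.subset[OF assms] that] by auto
    show "r = r'" if "r \<in> s ` (rcosets C)" "r' \<in> s ` (rcosets C)" "r \<otimes> inv r' \<in> C" for r r'
      using that s coset_eq_iff[OF assms] by (metis imageE)
  qed
qed

end

text \<open>The 3-cycle case of \<open>index_four_cases\<close>: \<open>x\<close> and its square fix
  no coset besides \<open>C\<close>, the cube fixes all of them, and the other three cosets form one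
  orbit.\<close>

locale a4_extension = finite_group +
  fixes x C K
  assumes x: "x \<in> carrier G" and index: "order G = 4 * ord x"
    and C_def: "C = generate G {x}" and K_def: "K = generate G {x [^] (3::nat)}"
    and conj_x: "g \<in> carrier G \<Longrightarrow> g \<notin> C \<Longrightarrow> g \<otimes> x \<otimes> inv g \<notin> C"
    and conj_x2: "g \<in> carrier G \<Longrightarrow> g \<notin> C \<Longrightarrow> g \<otimes> x [^] (2::nat) \<otimes> inv g \<notin> C"
    and conj_x3: "g \<in> carrier G \<Longrightarrow> g \<notin> C \<Longrightarrow> g \<otimes> x [^] (3::nat) \<otimes> inv g \<in> C"
    and transitive: "g \<in> carrier G \<Longrightarrow> g \<notin> C \<Longrightarrow> h \<in> carrier G \<Longrightarrow> h \<notin> C \<Longrightarrow>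
      \<exists>i<3::nat. h \<otimes> inv (g \<otimes> x [^] i) \<in> C"
begin

sublocale C: subgroup C G
  unfolding C_def using x by (rule subgroup_generate)

sublocale K: subgroup K G
  unfolding K_def using x by (intro subgroup_generate) simp

lemma pow_C: "x [^] (i::nat) \<in> C"
  using x by (auto simp: C_def in_generate_iff)

lemma x_in_C: "x \<in> C"
  using pow_C[of 1] x by simp

lemma C_cases: "c \<in> C \<Longrightarrow> \<exists>i::nat. c = x [^] i"
  using x by (auto simp: C_def in_generate_iff)

lemma C_commute: "a \<in> C \<Longrightarrow> b \<in> C \<Longrightarrow> a \<otimes> b = b \<otimes> a"
  using generate_commute[OF x] by (simp add: C_def)

lemma inv_notin_C: "g \<in> carrier G \<Longrightarrow> g \<notin> C \<Longrightarrow> inv g \<notin> C"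
  using C.m_inv_closed inv_inv by metis

lemma ex_notin_C: "\<exists>h. h \<in> carrier G \<and> h \<notin> C"
proof (rule ccontr)
  assume "\<not> ?thesis"
  then have "carrier G \<subseteq> C" by auto
  then have "order G \<le> ord x"
    using card_mono[of C "carrier G"] C.subset card_generate[OF x] finite_subset
    by (metis C_def finite_carrier order_def card_mono)
  then show False using index ord_pos[OF x] by simp
qed

text \<open>Transitivity on the other cosets makes \<open>C\<close> a maximal subgroup.\<close>

lemma subgroup_eq_carrier:
  assumes "subgroup M G" "x \<in> M" "m \<in> M" "m \<notin> C"
  shows "M = carrier G"
proof
  interpret M: subgroup M G by fact
  show "M \<subseteq> carrier G" by (rule M.subset)
  have CM: "C \<subseteq> M" unfolding C_def using assms(1,2) by (rule generate_subset)
  show "carrier G \<subseteq> M"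
  proof
    fix g assume g: "g \<in> carrier G"
    show "g \<in> M"
    proof (cases "g \<in> C")
      case False
      have m: "m \<in> carrier G" using assms(3) by simp
      obtain i :: nat where i: "g \<otimes> inv (m \<otimes> x [^] i) \<in> C"
        using transitive[OF m assms(4) g False] by auto
      have "m \<otimes> x [^] i \<in> M" using assms(3) pow_C CM by blast
      then have "g \<otimes> inv (m \<otimes> x [^] i) \<otimes> (m \<otimes> x [^] i) \<in> M" using i CM by blast
      then show ?thesis using g m x by (simp add: m_assoc)
    qed (use CM in auto)
  qed
qed

text \<open>For \<open>h\<close> outside \<open>C\<close>, the conjugate of the cube by
  \<open>inv h\<close> lies in the abelian group \<open>C\<close> and commutes with
  \<open>x\<close>. Conjugating back, the cube commutes with
  \<open>h \<otimes> x \<otimes> inv h\<close>, which is outside \<open>C\<close>; maximality of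
  \<open>C\<close> concludes.\<close>

lemma x3_central:
  assumes "g \<in> carrier G"
  shows "g \<otimes> x [^] (3::nat) = x [^] (3::nat) \<otimes> g"
proof -
  define y where "y = x [^] (3::nat)"
  have y: "y \<in> carrier G" using x by (simp add: y_def)
  obtain h where h: "h \<in> carrier G" "h \<notin> C" using ex_notin_C by auto
  define M where "M = {m \<in> carrier G. m \<otimes> y = y \<otimes> m}"
  have "M = carrier G"
  proof (rule subgroup_eq_carrier)
    show "subgroup M G" unfolding M_def using y by (rule subgroup_centralizer)
    show "x \<in> M" using C_commute[OF x_in_C pow_C] x by (simp add: M_def y_def)
    define t where "t = inv h \<otimes> y \<otimes> h"
    have tC: "t \<in> C" using conj_x3[of "inv h"] inv_notin_C[OF h] h by (simp add: t_def y_def)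
    have t: "t \<in> carrier G" "x \<otimes> t = t \<otimes> x" using tC C_commute[OF x_in_C] by auto
    have th: "h \<otimes> t = y \<otimes> h" "t \<otimes> inv h = inv h \<otimes> y"
      using h y by (simp_all add: t_def m_assoc[symmetric]) (simp add: m_assoc)
    have "h \<otimes> x \<otimes> inv h \<otimes> y = h \<otimes> x \<otimes> (inv h \<otimes> y)" using h x y by (simp add: m_assoc)
    also have "\<dots> = h \<otimes> (x \<otimes> t) \<otimes> inv h" using h x y t(1) by (simp add: m_assoc flip: th(2))
    also have "\<dots> = (h \<otimes> t) \<otimes> x \<otimes> inv h" unfolding t(2) using h x t(1) by (simp add: m_assoc)
    also have "\<dots> = y \<otimes> (h \<otimes> x \<otimes> inv h)" unfolding th(1) using h x y by (simp add: m_assoc)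
    finally show "h \<otimes> x \<otimes> inv h \<in> M" using h x by (simp add: M_def)
    show "h \<otimes> x \<otimes> inv h \<notin> C" using conj_x h by simp
  qed
  then show ?thesis using assms by (auto simp: M_def y_def)
qed

lemma K_central:
  assumes "z \<in> K" "g \<in> carrier G"
  shows "g \<otimes> z = z \<otimes> g"
proof -
  have "x [^] (3::nat) \<in> {m \<in> carrier G. m \<otimes> g = g \<otimes> m}"
    using x x3_central[OF assms(2)] by simp
  then have "K \<subseteq> {m \<in> carrier G. m \<otimes> g = g \<otimes> m}"
    unfolding K_def using assms(2) by (intro generate_subset subgroup_centralizer)
  then show ?thesis using assms(1) by auto
qed

lemma K_conj: "z \<in> K \<Longrightarrow> g \<in> carrier G \<Longrightarrow> g \<otimes> z \<otimes> inv g = z"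
  by (subst K_central) (simp_all add: m_assoc)

lemma x3_powers: "x [^] (3 * i :: nat) \<in> K"
proof -
  have "x [^] (3 * i) = (x [^] (3::nat)) [^] i" using x by (simp add: nat_pow_pow)
  then show ?thesis unfolding K_def in_generate_iff[OF nat_pow_closed[OF x]] by blast
qed

lemma K_subset_C: "K \<subseteq> C"
  unfolding K_def using pow_C C.subgroup_axioms by (rule generate_subset[rotated])

text \<open>Powers of the central cube pass through the conjugation, so only exponents 1 and 2
  remain.\<close>

lemma conj_pow_notin_C:
  assumes "g \<in> carrier G" "g \<notin> C" "\<not> 3 dvd (i::nat)"
  shows "g \<otimes> x [^] i \<otimes> inv g \<notin> C"
proof
  define r l where "r = i mod 3" and "l = i div 3"
  assume "g \<otimes> x [^] i \<otimes> inv g \<in> C"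
  moreover have "x [^] i = x [^] (3 * l) \<otimes> x [^] r" using x by (simp add: nat_pow_mult r_def l_def)
  moreover have "g \<otimes> (x [^] (3 * l) \<otimes> x [^] r) \<otimes> inv g = x [^] (3 * l) \<otimes> (g \<otimes> x [^] r \<otimes> inv g)"
  proof -
    have "g \<otimes> (x [^] (3 * l) \<otimes> x [^] r) \<otimes> inv g = (g \<otimes> x [^] (3 * l)) \<otimes> x [^] r \<otimes> inv g"
      using assms(1) x by (simp add: m_assoc)
    also have "\<dots> = (x [^] (3 * l) \<otimes> g) \<otimes> x [^] r \<otimes> inv g"
      using K_central[OF x3_powers assms(1)] by simp
    finally show ?thesis using assms(1) x by (simp add: m_assoc)
  qed
  ultimately have "inv (x [^] (3 * l)) \<otimes> (x [^] (3 * l) \<otimes> (g \<otimes> x [^] r \<otimes> inv g)) \<in> C"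
    using pow_C by simp
  then have "g \<otimes> x [^] r \<otimes> inv g \<in> C"
    using assms(1) x by (simp add: m_assoc[symmetric])
  moreover have "r = 1 \<or> r = 2"
    using assms(3) by (auto simp: r_def dvd_eq_mod_eq_0)
  ultimately show False using conj_x[OF assms(1,2)] conj_x2[OF assms(1,2)] x by auto
qed

text \<open>If 3 did not divide the order, \<open>x\<close> would be a power of its cube, hence
  central, against \<open>conj_x\<close>.\<close>

lemma ord_x: "ord x = 3 * card K"
proof -
  have "3 dvd ord x"
  proof (rule ccontr)
    assume "\<not> 3 dvd ord x"
    moreover have "Factorial_Ring.prime (3::nat)" by simp
    ultimately have "coprime 3 (ord x)" by (metis prime_imp_coprime)
    then have "x \<in> K" using in_generate_pow_coprime[OF x, of 3] by (simp add: K_def)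
    moreover obtain h where "h \<in> carrier G" "h \<notin> C" using ex_notin_C by auto
    ultimately show False using conj_x K_conj x_in_C by metis
  qed
  then show ?thesis using x by (simp add: K_def card_generate ord_pow)
qed

lemma order_eq: "order G = 12 * card K"
  using index ord_x by simp

lemma card_K_pos: "card K > 0"
  using ord_x ord_pos[OF x] by simp

lemma finite_K: "finite K"
  using card_K_pos by (rule card_ge_0_finite)

lemma C_minus_K:
  assumes "c \<in> C - K"
  shows "\<exists>i::nat. \<not> 3 dvd i \<and> c = x [^] i"
proof -
  obtain i :: nat where "c = x [^] i" using assms C_cases by auto
  moreover have "\<not> 3 dvd i" using assms x3_powers calculation by (auto elim!: dvdE)
  ultimately show ?thesis by auto
qed

lemma card_C_minus_K: "card (C - K) = 2 * card K"
  using card_Diff_subset[OF finite_K K_subset_C] ord_x card_generate[OF x] by (simp add: C_def)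

lemma sum_ord_C_minus_K: "(\<Sum>c\<in>C - K. ord c) + cyclic_psi (card K) = cyclic_psi (3 * card K)"
proof -
  have "finite C" using C.subset finite_carrier by (rule finite_subset)
  moreover have "(\<Sum>c\<in>C. ord c) = cyclic_psi (3 * card K)"
    using sum_ord_generate[OF x] ord_x by (simp add: C_def)
  moreover have "(\<Sum>c\<in>K. ord c) = cyclic_psi (card K)"
    using sum_ord_generate[of "x [^] (3::nat)"] card_generate[of "x [^] (3::nat)"] x by (simp add: K_def)
  ultimately show ?thesis using sum.subset_diff[OF K_subset_C, of ord] by simp
qed

section \<open>Counting orders on the conjugates of \<open>C\<close> and on their complement\<close>

definition W where "W = {g \<otimes> c \<otimes> inv g | g c. g \<in> carrier G \<and> c \<in> C - K}"

text \<open>In terms of the quotient by \<open>K\<close>, a copy of \<open>A\<^sub>4\<close>, the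
  set \<open>W\<close> lies over the eight elements of order 3 and \<open>S\<close> over the three
  involutions.\<close>

definition S where "S = carrier G - W - K"

lemma W_memI: "g \<in> carrier G \<Longrightarrow> c \<in> C - K \<Longrightarrow> g \<otimes> c \<otimes> inv g \<in> W"
  by (auto simp: W_def)

lemma W_subset: "W \<subseteq> carrier G"
  by (auto simp: W_def)

text \<open>An element of \<open>C - K\<close> can only be conjugated back into \<open>C\<close> by
  elements of \<open>C\<close>. Hence the four conjugates of \<open>C\<close> are disjoint outside
  \<open>K\<close>, one for each right coset.\<close>

lemma W_parametrization:
  obtains R where "card R = 4"
    "bij_betw (\<lambda>(r, c). inv r \<otimes> c \<otimes> r) (R \<times> (C - K)) W" "R \<subseteq> carrier G"
proof -
  obtain R where R: "R \<subseteq> carrier G" "card R * card C = order G"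
    "\<And>g. g \<in> carrier G \<Longrightarrow> \<exists>r\<in>R. g \<otimes> inv r \<in> C"
    "\<And>r r'. r \<in> R \<Longrightarrow> r' \<in> R \<Longrightarrow> r \<otimes> inv r' \<in> C \<Longrightarrow> r = r'"
    using transversal[OF C.subgroup_axioms] by metis
  have "card C = ord x" using card_generate[OF x] by (simp add: C_def)
  then have "card R = 4" using R(2) index ord_pos[OF x] by simp
  moreover have "inj_on (\<lambda>(r, c). inv r \<otimes> c \<otimes> r) (R \<times> (C - K))"
  proof (rule inj_onI, clarify)
    fix r c r' c'
    assume r: "r \<in> R" "r' \<in> R" and c: "c \<in> C" "c \<notin> K" "c' \<in> C" "c' \<notin> K"
      and eq: "inv r \<otimes> c \<otimes> r = inv r' \<otimes> c' \<otimes> r'"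
    have rG: "r \<in> carrier G" "r' \<in> carrier G" using r R(1) by auto
    define g where "g = r \<otimes> inv r'"
    have g: "g \<in> carrier G" "inv g = r' \<otimes> inv r" using rG by (auto simp: g_def inv_mult_group)
    have "c = r \<otimes> (inv r \<otimes> c \<otimes> r) \<otimes> inv r" 
      using rG c by (simp add: m_assoc) (simp add: m_assoc[symmetric])
    also have "\<dots> = g \<otimes> c' \<otimes> inv g"
      unfolding eq g(2) using rG c by (simp add: g_def m_assoc)
    finally have "g \<otimes> c' \<otimes> inv g \<in> C" using c by simp
    then have "g \<in> C" using C_minus_K[of c'] conj_pow_notin_C[OF g(1)] c by auto
    then have "r = r'" using R(4) r by (simp add: g_def)
    then show "r = r' \<and> c = c'" using eq rG c by simp
  qed
  moreover have "(\<lambda>(r, c). inv r \<otimes> c \<otimes> r) ` (R \<times> (C - K)) = W"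
  proof
    show "(\<lambda>(r, c). inv r \<otimes> c \<otimes> r) ` (R \<times> (C - K)) \<subseteq> W"
    proof clarify
      fix r c assume "r \<in> R" "c \<in> C" "c \<notin> K"
      then show "inv r \<otimes> c \<otimes> r \<in> W" using W_memI[of "inv r" c] R(1) by auto
    qed
    show "W \<subseteq> (\<lambda>(r, c). inv r \<otimes> c \<otimes> r) ` (R \<times> (C - K))"
    proof
      fix w assume "w \<in> W"
      then obtain g c where w: "w = g \<otimes> c \<otimes> inv g" "g \<in> carrier G" "c \<in> C" "c \<notin> K"
        by (auto simp: W_def)
      obtain r where r: "r \<in> R" "inv g \<otimes> inv r \<in> C" using R(3)[of "inv g"] w(2) by auto
      define a where "a = inv g \<otimes> inv r"
      have rG: "r \<in> carrier G" and aG: "a \<in> carrier G" using r R(1) w(2) by (auto simp: a_def)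
      have ig: "inv g = a \<otimes> r" using rG w(2) by (simp add: a_def m_assoc)
      have "g = inv (a \<otimes> r)" using ig w(2) by (metis inv_inv)
      then have g: "g = inv r \<otimes> inv a" using rG aG by (simp add: inv_mult_group)
      have "w = inv r \<otimes> (inv a \<otimes> (c \<otimes> a)) \<otimes> r"
        unfolding w(1) ig using rG aG w(3) by (simp add: g m_assoc)
      also have "c \<otimes> a = a \<otimes> c" using C_commute w(3) r(2) by (simp add: a_def)
      also have "inv a \<otimes> (a \<otimes> c) = c" using aG w(3) by (simp add: m_assoc[symmetric])
      finally show "w \<in> (\<lambda>(r, c). inv r \<otimes> c \<otimes> r) ` (R \<times> (C - K))" using r(1) w(3,4) by auto
    qed
  qed
  ultimately show ?thesis using that R(1) by (simp add: bij_betw_def)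
qed

lemma card_W: "card W = 8 * card K"
proof -
  obtain R where R: "card R = 4"
    "bij_betw (\<lambda>(r, c). inv r \<otimes> c \<otimes> r) (R \<times> (C - K)) W" by (rule W_parametrization)
  have "card W = card (R \<times> (C - K))" using bij_betw_same_card[OF R(2)] by simp
  then show ?thesis using R(1) card_C_minus_K by (simp add: card_cartesian_product)
qed

lemma sum_ord_W: "(\<Sum>w\<in>W. ord w) = 4 * (\<Sum>c\<in>C - K. ord c)"
proof -
  obtain R where R: "card R = 4" "R \<subseteq> carrier G"
    "bij_betw (\<lambda>(r, c). inv r \<otimes> c \<otimes> r) (R \<times> (C - K)) W" by (rule W_parametrization)
  have "ord (inv r \<otimes> c \<otimes> r) = ord c" if "r \<in> R" "c \<in> C - K" for r c
  proof -
    have "r \<in> carrier G" "c \<in> carrier G" using that R(2) by auto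
    then show ?thesis using ord_conj[of "inv r" c] by simp
  qed
  then have "(\<Sum>w\<in>W. ord w) = (\<Sum>(r, c)\<in>R \<times> (C - K). ord c)"
    by (subst sum.reindex_bij_betw[OF R(3), symmetric]) (auto intro!: sum.cong)
  also have "\<dots> = 4 * (\<Sum>c\<in>C - K. ord c)"
    using R(1) by (simp add: sum.cartesian_product[symmetric])
  finally show ?thesis .
qed

lemma W_K_disjoint: "W \<inter> K = {}"
proof -
  have False if w: "g \<in> carrier G" "c \<in> C" "c \<notin> K" "g \<otimes> c \<otimes> inv g \<in> K" for g c
  proof -
    have "inv g \<otimes> (g \<otimes> c \<otimes> inv g) \<otimes> inv (inv g) = g \<otimes> c \<otimes> inv g"
      using K_conj[OF w(4), of "inv g"] w(1) by simp
    moreover have "inv g \<otimes> (g \<otimes> c \<otimes> inv g) \<otimes> inv (inv g) = c"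
      using w(1,2) by (simp add: m_assoc) (simp add: m_assoc[symmetric])
    ultimately show False using w(3,4) by simp
  qed
  then show ?thesis by (auto simp: W_def)
qed

lemma C_subset: "C \<subseteq> W \<union> K"
proof
  fix c assume "c \<in> C"
  then show "c \<in> W \<union> K" using W_memI[of \<one> c] by auto
qed

lemma card_S: "card S = 3 * card K"
proof -
  have "finite W" using W_subset finite_carrier by (rule finite_subset)
  then have "card (carrier G - W) = 4 * card K"
    using W_subset card_W order_eq by (simp add: card_Diff_subset order_def)
  moreover have "K \<subseteq> carrier G - W" using W_K_disjoint K.subset by auto
  ultimately show ?thesis unfolding S_def using finite_K by (simp add: card_Diff_subset)
qed

lemma psi_split: "psi G = (\<Sum>w\<in>W. ord w) + cyclic_psi (card K) + (\<Sum>g\<in>S. ord g)"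
proof -
  have "(\<Sum>c\<in>K. ord c) = cyclic_psi (card K)"
    using sum_ord_generate[of "x [^] (3::nat)"] card_generate[of "x [^] (3::nat)"] x by (simp add: K_def)
  moreover have "psi G = (\<Sum>g\<in>carrier G - W. ord g) + (\<Sum>w\<in>W. ord w)"
    unfolding psi_def using W_subset by (intro sum.subset_diff) auto
  moreover have "(\<Sum>g\<in>carrier G - W. ord g) = (\<Sum>g\<in>S. ord g) + (\<Sum>c\<in>K. ord c)"
    unfolding S_def using W_K_disjoint K.subset by (intro sum.subset_diff) auto
  ultimately show ?thesis by simp
qed

lemma S_carrier: "y \<in> S \<Longrightarrow> y \<in> carrier G"
  by (simp add: S_def)

lemma S_notin_C: "y \<in> S \<Longrightarrow> y \<notin> C"
  using C_subset by (auto simp: S_def)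

lemma S_conj:
  assumes "y \<in> S" "g \<in> carrier G"
  shows "g \<otimes> y \<otimes> inv g \<in> S"
proof -
  have y: "y \<in> carrier G" "y \<notin> W" "y \<notin> K" using assms(1) by (auto simp: S_def)
  have cancel_eq: "inv g \<otimes> (g \<otimes> y \<otimes> inv g) \<otimes> g = y"
    using assms(2) y(1) by (simp add: m_assoc) (simp add: m_assoc[symmetric])
  have "g \<otimes> y \<otimes> inv g \<notin> W"
  proof
    assume "g \<otimes> y \<otimes> inv g \<in> W"
    then obtain h c where h: "g \<otimes> y \<otimes> inv g = h \<otimes> c \<otimes> inv h" "h \<in> carrier G" "c \<in> C - K"
      by (auto simp: W_def)
    have "y = (inv g \<otimes> h) \<otimes> c \<otimes> inv (inv g \<otimes> h)"
      using cancel_eq h assms(2) by (simp add: m_assoc inv_mult_group)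
    then show False using W_memI[of "inv g \<otimes> h" c] h assms(2) y(2) by simp
  qed
  moreover have "g \<otimes> y \<otimes> inv g \<notin> K"
  proof
    assume K: "g \<otimes> y \<otimes> inv g \<in> K"
    then show False using cancel_eq K_conj[OF K, of "inv g"] assms(2) y(3) by simp
  qed
  ultimately show ?thesis using assms y by (simp add: S_def)
qed

text \<open>As \<open>K\<close> is central, \<open>W\<close> is a union of cosets of
  \<open>K\<close>, and so is its complement.\<close>

lemma S_mult_K:
  assumes "y \<in> S" "z \<in> K"
  shows "y \<otimes> z \<in> S"
proof -
  have y: "y \<in> carrier G" "y \<notin> W" "y \<notin> K" using assms(1) by (auto simp: S_def)
  have z: "z \<in> carrier G" "inv z \<in> K" using assms(2) by auto
  have cancel_eq: "y \<otimes> z \<otimes> inv z = y" using y z by (simp add: m_assoc)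
  have "y \<otimes> z \<notin> W"
  proof
    assume "y \<otimes> z \<in> W"
    then obtain h c where h: "y \<otimes> z = h \<otimes> c \<otimes> inv h" "h \<in> carrier G" "c \<in> C" "c \<notin> K"
      by (auto simp: W_def)
    have "y = h \<otimes> c \<otimes> (inv h \<otimes> inv z)" using cancel_eq h z by (simp add: m_assoc)
    also have "inv h \<otimes> inv z = inv z \<otimes> inv h" using K_central[OF z(2), of "inv h"] h(2) by simp
    finally have "y = h \<otimes> (c \<otimes> inv z) \<otimes> inv h" using h z by (simp add: m_assoc)
    moreover have "c \<otimes> inv z \<in> C - K"
    proof -
      have "c \<otimes> inv z \<notin> K"
      proof
        assume "c \<otimes> inv z \<in> K"
        then have "c \<otimes> inv z \<otimes> z \<in> K" using assms(2) by simp
        then show False using h z by (simp add: m_assoc)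
      qed
      then show ?thesis using h(3) z(2) K_subset_C by auto
    qed
    ultimately show False using W_memI[OF h(2)] y(2) by simp
  qed
  moreover have "y \<otimes> z \<notin> K"
  proof
    assume "y \<otimes> z \<in> K"
    then have "y \<otimes> z \<otimes> inv z \<in> K" using z by blast
    then show False using cancel_eq y by simp
  qed
  ultimately show ?thesis using y z by (simp add: S_def)
qed

text \<open>If conjugates of the coset \<open>y K\<close> by two powers of \<open>x\<close> met,
  \<open>inv y\<close> would conjugate \<open>x [^] e\<close> into \<open>C\<close>, with
  \<open>e\<close> the difference of exponents; this forces 3 to divide \<open>e\<close>. The three
  disjoint cosets exhaust \<open>S\<close> by cardinality.\<close>

lemma S_parametrization:
  assumes y: "y \<in> S"
  shows "bij_betw (\<lambda>(i, z). x [^] i \<otimes> (y \<otimes> z) \<otimes> inv (x [^] i)) ({..<3::nat} \<times> K) S"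
proof -
  define F where "F = (\<lambda>(i::nat, z). x [^] i \<otimes> (y \<otimes> z) \<otimes> inv (x [^] i))"
  have yG: "y \<in> carrier G" and yC: "inv y \<notin> C"
    using S_carrier[OF y] S_notin_C[OF y] inv_notin_C by auto
  have aux: "i = j \<and> z = z'"
    if ij: "i \<le> j" "j < 3" and z: "z \<in> K" "z' \<in> K" and eq: "F (i, z) = F (j, z')" for i j z z'
  proof -
    define e where "e = j - i"
    have zG: "z \<in> carrier G" "z' \<in> carrier G" "inv z' \<in> K" using z by auto
    have xj: "x [^] j = x [^] i \<otimes> x [^] e" using ij x by (simp add: nat_pow_mult e_def)
    have "inv (x [^] i) \<otimes> F (i, z) \<otimes> x [^] i = y \<otimes> z"
      using x yG zG by (simp add: F_def m_assoc) (simp add: m_assoc[symmetric])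
    moreover have "inv (x [^] i) \<otimes> F (j, z') \<otimes> x [^] i = x [^] e \<otimes> (y \<otimes> z') \<otimes> inv (x [^] e)"
      unfolding F_def prod.case xj
      using x yG zG by (simp add: m_assoc inv_mult_group) (simp add: m_assoc[symmetric])
    ultimately have "y \<otimes> z = x [^] e \<otimes> (y \<otimes> z') \<otimes> inv (x [^] e)" using eq by simp
    then have "y \<otimes> z \<otimes> x [^] e = x [^] e \<otimes> y \<otimes> z'"
      using x yG zG by (simp add: m_assoc)
    then have "inv y \<otimes> (y \<otimes> z \<otimes> x [^] e) \<otimes> inv z' = inv y \<otimes> (x [^] e \<otimes> y \<otimes> z') \<otimes> inv z'" by simp
    moreover have "inv y \<otimes> (y \<otimes> z \<otimes> x [^] e) \<otimes> inv z' = z \<otimes> x [^] e \<otimes> inv z'"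
      using x yG zG by (simp add: m_assoc[symmetric])
    moreover have "inv y \<otimes> (x [^] e \<otimes> y \<otimes> z') \<otimes> inv z' = inv y \<otimes> x [^] e \<otimes> y"
      using x yG zG by (simp add: m_assoc)
    ultimately have *: "z \<otimes> x [^] e \<otimes> inv z' = inv y \<otimes> x [^] e \<otimes> y" by simp
    have "z \<otimes> x [^] e \<otimes> inv z' \<in> C" using z zG K_subset_C pow_C by blast
    then have "inv y \<otimes> x [^] e \<otimes> inv (inv y) \<in> C" using * yG by simp
    then have "3 dvd e" using conj_pow_notin_C[OF _ yC] yG by auto
    then have "e = 0" using ij by (auto simp: e_def dest: dvd_imp_le)
    then have "z \<otimes> inv z' = \<one>" using * yG zG by simp
    then have "z = z'" using zG by (metis inv_solve_right' l_one one_closed)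
    then show ?thesis using \<open>e = 0\<close> ij by (simp add: e_def)
  qed
  have "inj_on F ({..<3} \<times> K)"
  proof (rule inj_onI, clarify)
    fix i z j z' assume "i < 3" "j < 3" "z \<in> K" "z' \<in> K" "F (i, z) = F (j, z')"
    then show "i = j \<and> z = z'"
      using aux[of i j z z'] aux[of j i z' z] by (cases "i \<le> j") auto
  qed
  moreover have "F ` ({..<3} \<times> K) = S"
  proof (rule card_subset_eq)
    show "finite S" using finite_carrier by (rule finite_subset[rotated]) (auto simp: S_def)
    show "F ` ({..<3} \<times> K) \<subseteq> S"
      using S_conj[OF S_mult_K[OF y]] x by (auto simp: F_def)
    show "card (F ` ({..<3} \<times> K)) = card S"
      using \<open>inj_on F _\<close> by (simp add: card_image card_cartesian_product card_S)
  qed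
  ultimately show ?thesis unfolding bij_betw_def F_def by blast
qed

lemma ex_S: "\<exists>y. y \<in> S"
  using card_S card_K_pos by (metis card.empty ex_in_conv mult_eq_0_iff not_gr_zero zero_neq_numeral)

text \<open>Conjugation by \<open>x\<close> permutes the three cosets of \<open>K\<close> in \<open>S\<close> cyclically and commutes with
  inversion, so inversion fixes each of them.\<close>

lemma S_square:
  assumes y: "y \<in> S"
  shows "y \<otimes> y \<in> K"
proof -
  have yG: "y \<in> carrier G" and yC: "inv y \<notin> C"
    using S_carrier[OF y] S_notin_C[OF y] inv_notin_C by auto
  have inv_S: "inv y \<in> S"
  proof -
    have "inv y \<notin> W"
    proof
      assume "inv y \<in> W"
      then obtain g c where gc: "inv y = g \<otimes> c \<otimes> inv g" "g \<in> carrier G" "c \<in> C" "c \<notin> K"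
        by (auto simp: W_def)
      have "y = inv (g \<otimes> c \<otimes> inv g)" using gc(1) yG by (metis inv_inv)
      also have "\<dots> = g \<otimes> inv c \<otimes> inv g" using gc by (simp add: inv_mult_group m_assoc)
      finally have "y = g \<otimes> inv c \<otimes> inv g" .
      moreover have "inv c \<in> C - K" using gc K.m_inv_closed inv_inv C.mem_carrier by (metis C.m_inv_closed DiffI)
      ultimately show False using W_memI[OF gc(2)] y by (simp add: S_def)
    qed
    moreover have "inv y \<notin> K"
      using y yG K.m_inv_closed by (metis DiffE S_def inv_inv)
    ultimately show ?thesis using yG by (simp add: S_def)
  qed
  obtain p where p: "p \<in> {..<3::nat} \<times> K"
    "inv y = (case p of (i, z) \<Rightarrow> x [^] i \<otimes> (y \<otimes> z) \<otimes> inv (x [^] i))"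
    using inv_S bij_betw_imp_surj_on[OF S_parametrization[OF y]] by blast
  then obtain i z where iz: "i < (3::nat)" "z \<in> K"
    "inv y = x [^] i \<otimes> (y \<otimes> z) \<otimes> inv (x [^] i)" by (cases p) (auto intro: that)
  define w where "w = x [^] i"
  have wG: "w \<in> carrier G" using x by (simp add: w_def)
  have zG: "z \<in> carrier G" using iz by simp
  have inv_y: "inv y = w \<otimes> y \<otimes> inv w \<otimes> z"
  proof -
    have "inv y = w \<otimes> y \<otimes> (z \<otimes> inv w)" using iz(3) wG yG zG by (simp add: w_def m_assoc)
    also have "z \<otimes> inv w = inv w \<otimes> z" using K_central[OF iz(2), of "inv w"] wG by simp
    finally show ?thesis using wG yG zG by (simp add: m_assoc)
  qed
  \<comment> \<open>Inverting twice applies the conjugation by \<open>w\<close> twice, and the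
    central factor \<open>z\<close> cancels.\<close>
  have "y = inv (w \<otimes> y \<otimes> inv w \<otimes> z)" using inv_y yG by (metis inv_inv)
  also have "\<dots> = inv z \<otimes> (w \<otimes> inv y \<otimes> inv w)" using wG yG zG by (simp add: inv_mult_group m_assoc)
  also have "\<dots> = inv z \<otimes> (w \<otimes> (w \<otimes> y \<otimes> inv w \<otimes> z) \<otimes> inv w)" using inv_y by simp
  also have "w \<otimes> (w \<otimes> y \<otimes> inv w \<otimes> z) \<otimes> inv w = w \<otimes> (w \<otimes> y \<otimes> inv w) \<otimes> (z \<otimes> inv w)"
    using wG yG zG by (simp add: m_assoc)
  also have "z \<otimes> inv w = inv w \<otimes> z" using K_central[OF iz(2), of "inv w"] wG by simp
  also have "w \<otimes> (w \<otimes> y \<otimes> inv w) \<otimes> (inv w \<otimes> z) = w \<otimes> w \<otimes> y \<otimes> inv w \<otimes> inv w \<otimes> z"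
    using wG yG zG by (simp add: m_assoc)
  also have "\<dots> = z \<otimes> (w \<otimes> w \<otimes> y \<otimes> inv w \<otimes> inv w)"
    using K_central[OF iz(2), of "w \<otimes> w \<otimes> y \<otimes> inv w \<otimes> inv w"] wG yG by simp
  also have "inv z \<otimes> (z \<otimes> (w \<otimes> w \<otimes> y \<otimes> inv w \<otimes> inv w)) = w \<otimes> w \<otimes> y \<otimes> inv w \<otimes> inv w"
    using wG yG zG by (simp add: m_assoc[symmetric])
  finally have y_eq: "y = w \<otimes> w \<otimes> y \<otimes> inv w \<otimes> inv w" .
  have "y \<otimes> (w \<otimes> w) = w \<otimes> w \<otimes> y \<otimes> inv w \<otimes> inv w \<otimes> (w \<otimes> w)" using y_eq by simp
  also have "\<dots> = w \<otimes> w \<otimes> y \<otimes> (inv w \<otimes> (inv w \<otimes> w) \<otimes> w)"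
    using wG yG by (simp only: m_assoc m_closed inv_closed)
  also have "\<dots> = w \<otimes> w \<otimes> y" using wG yG by simp
  finally have comm: "y \<otimes> (w \<otimes> w) = w \<otimes> w \<otimes> y" .
  have "w \<otimes> w = x [^] (i + i)" using x by (simp add: w_def nat_pow_mult)
  then have "inv y \<otimes> x [^] (i + i) \<otimes> inv (inv y) = inv y \<otimes> (y \<otimes> (w \<otimes> w))"
    using comm yG wG x by (simp add: m_assoc)
  also have "\<dots> = x [^] (i + i)"
    using \<open>w \<otimes> w = _\<close> yG wG x by (simp add: m_assoc[symmetric])
  \<comment> \<open>Since \<open>y\<close> commutes with \<open>x [^] (i + i)\<close>, it conjugates
    this power into \<open>C\<close>; as \<open>i < 3\<close>, only \<open>i = 0\<close>
    remains.\<close>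
  finally have "3 dvd i + i" using conj_pow_notin_C[OF _ yC, of "i + i"] yG pow_C by auto
  then have "i = 0" using iz(1) by presburger
  then have "inv y = y \<otimes> z" using inv_y yG zG by (simp add: w_def)
  then have "y \<otimes> y \<otimes> z = \<one>" using yG zG by (metis m_assoc r_inv)
  then have "y \<otimes> y = inv z" using yG zG by (simp add: inv_equality[symmetric])
  then show ?thesis using iz(2) by simp
qed

lemma sum_ord_S:
  assumes y: "y \<in> S"
  shows "(\<Sum>g\<in>S. ord g) = 3 * (\<Sum>z\<in>K. ord (y \<otimes> z))"
proof -
  have "ord (x [^] i \<otimes> (y \<otimes> z) \<otimes> inv (x [^] i)) = ord (y \<otimes> z)" if "z \<in> K" for i :: nat and z
    using ord_conj[of "x [^] i" "y \<otimes> z"] x S_carrier[OF y] that by simp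
  then have "(\<Sum>g\<in>S. ord g) = (\<Sum>(i, z)\<in>{..<3::nat} \<times> K. ord (y \<otimes> z))"
    by (subst sum.reindex_bij_betw[OF S_parametrization[OF y], symmetric]) (auto intro!: sum.cong)
  then show ?thesis by (simp add: sum.cartesian_product[symmetric])
qed

lemma ord_le_ord_square:
  assumes "g \<in> carrier G"
  shows "ord g \<le> 2 * ord (g \<otimes> g)"
proof -
  have "g \<otimes> g = g [^] (2::nat)" using assms by (simp add: numeral_2_eq_2)
  then have "g [^] (2 * ord (g \<otimes> g)) = \<one>"
    using assms by (metis m_closed nat_pow_pow pow_ord_eq_1)
  then have "ord g dvd 2 * ord (g \<otimes> g)" using assms by (simp add: pow_eq_id)
  then show ?thesis using ord_pos[of "g \<otimes> g"] assms by (auto intro: dvd_imp_le)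
qed

text \<open>Squares of elements of \<open>S\<close> lie in \<open>K\<close>, so their orders are at
  most \<open>2 * card K\<close>. This crude bound on \<open>S\<close> suffices when
  \<open>card K\<close> is even.\<close>

lemma psi_le: "psi G + 3 * cyclic_psi (card K) \<le> 4 * cyclic_psi (3 * card K) + 6 * (card K)\<^sup>2"
proof -
  obtain y where y: "y \<in> S" using ex_S by auto
  have "ord (y \<otimes> z) \<le> 2 * card K" if z: "z \<in> K" for z
  proof -
    have s: "y \<otimes> z \<in> S" using S_mult_K[OF y z] .
    have "ord ((y \<otimes> z) \<otimes> (y \<otimes> z)) dvd card K"
      using ord_dvd_card_subgroup[OF K.subgroup_axioms S_square[OF s]] .
    then have "ord ((y \<otimes> z) \<otimes> (y \<otimes> z)) \<le> card K" using card_K_pos by (rule dvd_imp_le)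
    then show ?thesis using ord_le_ord_square[OF S_carrier[OF s]] by linarith
  qed
  then have "(\<Sum>z\<in>K. ord (y \<otimes> z)) \<le> of_nat (card K) * (2 * card K)"
    by (intro sum_bounded_above) auto
  then have "(\<Sum>g\<in>S. ord g) \<le> 6 * (card K)\<^sup>2"
    using sum_ord_S[OF y] by (simp add: power2_eq_square)
  then show ?thesis using psi_split sum_ord_W sum_ord_C_minus_K by linarith
qed

text \<open>For odd \<open>card K\<close> squaring is a bijection of \<open>K\<close>, so the
  squares of the elements of one coset \<open>y K\<close> run through all of \<open>K\<close>. Their
  orders then sum to Psi(|K|) instead of being bounded individually by \<open>card K\<close>; the
  crude bound would not exclude nontrivial 3-groups \<open>K\<close>.\<close>

lemma psi_le_odd:
  assumes "odd (card K)"
  shows "psi G \<le> 4 * cyclic_psi (3 * card K) + 3 * cyclic_psi (card K)"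
proof -
  obtain y where y: "y \<in> S" using ex_S by auto
  have yG: "y \<in> carrier G" using S_carrier[OF y] .
  define q where "q = y \<otimes> y"
  have q: "q \<in> K" using S_square[OF y] by (simp add: q_def)
  have le: "ord (y \<otimes> z) \<le> 2 * ord (q \<otimes> (z \<otimes> z))" if z: "z \<in> K" for z
  proof -
    have zG: "z \<in> carrier G" using z by simp
    have "(y \<otimes> z) \<otimes> (y \<otimes> z) = y \<otimes> (z \<otimes> y) \<otimes> z" using yG zG by (simp add: m_assoc)
    also have "z \<otimes> y = y \<otimes> z" using K_central[OF z yG] by simp
    finally have "(y \<otimes> z) \<otimes> (y \<otimes> z) = q \<otimes> (z \<otimes> z)" using yG zG by (simp add: q_def m_assoc)
    then show ?thesis using ord_le_ord_square[of "y \<otimes> z"] yG zG by simp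
  qed
  have inj: "inj_on (\<lambda>z. q \<otimes> (z \<otimes> z)) K"
  proof (rule inj_onI)
    fix a b assume ab: "a \<in> K" "b \<in> K" "q \<otimes> (a \<otimes> a) = q \<otimes> (b \<otimes> b)"
    have G: "a \<in> carrier G" "b \<in> carrier G" "q \<in> carrier G" using ab q by auto
    have sq: "a \<otimes> a = b \<otimes> b" using ab(3) G by simp
    define c where "c = a \<otimes> inv b"
    have c: "c \<in> K" "c \<in> carrier G" using ab G by (auto simp: c_def)
    have "c \<otimes> c = a \<otimes> (inv b \<otimes> a) \<otimes> inv b" using G by (simp add: c_def m_assoc)
    also have "inv b \<otimes> a = a \<otimes> inv b" using K_central[OF ab(1), of "inv b"] G by simp
    also have "a \<otimes> (a \<otimes> inv b) \<otimes> inv b = (a \<otimes> a) \<otimes> inv b \<otimes> inv b" using G by (simp add: m_assoc)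
    also have "\<dots> = \<one>" unfolding sq using G by (simp add: m_assoc)
    finally have "c [^] (2::nat) = \<one>" using c by (simp add: numeral_2_eq_2)
    then have "ord c dvd 2" using c by (simp add: pow_eq_id)
    moreover have "ord c dvd card K" using ord_dvd_card_subgroup[OF K.subgroup_axioms c(1)] .
    moreover have "coprime 2 (card K)" using assms by simp
    ultimately have "ord c = 1" by (metis coprime_common_divisor_nat)
    then have "a \<otimes> inv b = \<one>" using c ord_eq_1 by (simp add: c_def)
    then show "a = b" using G by (metis inv_solve_right' l_one one_closed)
  qed
  have "(\<lambda>z. q \<otimes> (z \<otimes> z)) ` K = K"
    using q by (intro card_subset_eq finite_K) (auto simp: card_image[OF inj])
  then have "(\<Sum>z\<in>K. ord (q \<otimes> (z \<otimes> z))) = (\<Sum>z\<in>K. ord z)"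
    using sum.reindex[OF inj, of ord] by (simp add: o_def)
  also have "\<dots> = cyclic_psi (card K)"
    using sum_ord_generate[of "x [^] (3::nat)"] card_generate[of "x [^] (3::nat)"] x by (simp add: K_def)
  finally have "(\<Sum>z\<in>K. 2 * ord (q \<otimes> (z \<otimes> z))) = 2 * cyclic_psi (card K)"
    by (simp flip: sum_distrib_left)
  moreover have "(\<Sum>z\<in>K. ord (y \<otimes> z)) \<le> (\<Sum>z\<in>K. 2 * ord (q \<otimes> (z \<otimes> z)))"
    using le by (rule sum_mono)
  ultimately have "(\<Sum>g\<in>S. ord g) \<le> 6 * cyclic_psi (card K)" using sum_ord_S[OF y] by linarith
  then show ?thesis using psi_split sum_ord_W sum_ord_C_minus_K by linarith
qed

lemma card_K_eq_1_if_psi_ge: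
  assumes k: "card K = 2 ^ s * 3 ^ t" and ge: "77 * psi G \<ge> 31 * cyclic_psi (12 * card K)"
  shows "card K = 1" "77 * psi G = 31 * cyclic_psi (12 * card K)"
proof -
  define u v where "u = cyclic_psi (2 ^ s)" and "v = cyclic_psi (3 ^ t)"
  have cop: "coprime ((2::nat) ^ a) (3 ^ b)" for a b by simp
  have u: "3 * u = 2 * 4 ^ s + 1"
    using cyclic_psi_prime_power[of 2 s] by (simp add: u_def power_mult)
  have v: "4 * v = 3 * 9 ^ t + 1"
    using cyclic_psi_prime_power[of 3 t] by (simp add: v_def power_mult)
  have u4: "cyclic_psi (2 ^ Suc (Suc s)) + 5 = 16 * u"
    using cyclic_psi_prime_power_Suc[of 2 s] cyclic_psi_prime_power_Suc[of 2 "Suc s"] by (simp add: u_def)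
  have v3: "cyclic_psi (3 ^ Suc t) + 2 = 9 * v"
    using cyclic_psi_prime_power_Suc[of 3 t] by (simp add: v_def)
  have psi1: "cyclic_psi (card K) = u * v"
    using cyclic_psi_mult_coprime[OF cop[of s t]] by (simp add: k u_def v_def)
  have psi3: "cyclic_psi (3 * card K) = u * cyclic_psi (3 ^ Suc t)"
    using cyclic_psi_mult_coprime[OF cop[of s "Suc t"]] by (simp add: k u_def mult.left_commute)
  have psi12: "cyclic_psi (12 * card K) = cyclic_psi (2 ^ Suc (Suc s)) * cyclic_psi (3 ^ Suc t)"
    using cyclic_psi_mult_coprime[OF cop[of "Suc (Suc s)" "Suc t"]] by (simp add: k mult.commute mult.left_commute)
  have ge': "77 * int (psi G) \<ge> 31 * ((16 * int u - 5) * (9 * int v - 2))"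
  proof -
    have "int (cyclic_psi (2 ^ Suc (Suc s))) = 16 * int u - 5" using u4 by linarith
    moreover have "int (cyclic_psi (3 ^ Suc t)) = 9 * int v - 2" using v3 by linarith
    ultimately have "int (cyclic_psi (12 * card K)) = (16 * int u - 5) * (9 * int v - 2)"
      by (simp only: psi12 of_nat_mult)
    then show ?thesis using ge by linarith
  qed
  have psi3': "int (cyclic_psi (3 * card K)) = int u * (9 * int v - 2)"
  proof -
    have "int (cyclic_psi (3 ^ Suc t)) = 9 * int v - 2" using v3 by linarith
    then show ?thesis by (simp only: psi3 of_nat_mult)
  qed
  have v1: "v \<ge> 1" using v by linarith
  \<comment> \<open>With \<open>s > 0\<close> one has \<open>u \<ge> 3\<close>, and 6 |K|^2 factors
    as (3u - 1)(4v - 1) by the closed forms. The crude bound then contradicts the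
    hypothesis.\<close>
  have s0: "s = 0"
  proof (rule ccontr)
    assume "s \<noteq> 0"
    then have "(4::nat) ^ 1 \<le> 4 ^ s" by (intro power_increasing) auto
    then have u3: "u \<ge> 3" using u by simp
    have "((2::nat) ^ s)\<^sup>2 = (2\<^sup>2) ^ s" "((3::nat) ^ t)\<^sup>2 = (3\<^sup>2) ^ t"
      by (simp_all only: power_mult[symmetric] mult.commute)
    then have "(card K)\<^sup>2 = 4 ^ s * 9 ^ t" by (simp add: k power_mult_distrib)
    then have "6 * int ((card K)\<^sup>2) = (2 * int (4 ^ s)) * (3 * int (9 ^ t))" by simp
    also have "2 * int (4 ^ s) = 3 * int u - 1" using u by linarith
    also have "3 * int (9 ^ t) = 4 * int v - 1" using v by linarith
    finally have sq: "6 * int ((card K)\<^sup>2) = (3 * int u - 1) * (4 * int v - 1)" .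
    have "int (psi G) + 3 * int u * int v \<le> 4 * (int u * (9 * int v - 2)) + (3 * int u - 1) * (4 * int v - 1)"
    proof -
      have "int (psi G) + 3 * int (cyclic_psi (card K)) \<le>
          4 * int (cyclic_psi (3 * card K)) + 6 * int ((card K)\<^sup>2)"
        using psi_le by linarith
      then show ?thesis unfolding sq psi3' psi1 of_nat_mult by (simp add: mult.assoc)
    qed
    then have "999 * (int u * int v) - 145 * int u - 1087 * int v + 233 \<le> 0"
      using ge' by (simp add: algebra_simps)
    \<comment> \<open>This product bounds the only nonlinear term from below and leaves a linear
      problem.\<close>
    moreover have "(int u - 3) * (int v - 1) \<ge> 0" using u3 v1 by simp
    then have "int u * int v \<ge> int u + 3 * int v - 3" by (simp add: algebra_simps)
    ultimately show False using u3 v1 by linarith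
  qed
  then have u1: "u = 1" using u by simp
  have "odd (card K)" using k s0 by simp
  \<comment> \<open>For \<open>u = 1\<close> the comparison reads 77 (39v - 8) >= 341 (9v - 2), that
    is 66v <= 66.\<close>
  then have *: "int (psi G) \<le> 4 * (9 * int v - 2) + 3 * int v"
    using psi_le_odd psi3' psi1 u1 by simp
  then have "v = 1" using ge' u1 v1 by simp
  then have "t = 0" using v by (cases t) auto
  then show "card K = 1" using k s0 by simp
  show "77 * psi G = 31 * cyclic_psi (12 * card K)"
    using * ge u1 \<open>v = 1\<close> psi12 u4 v3 by simp
qed

end

section \<open>The classification\<close>

lemma card_alt_group_4: "card (carrier (alt_group 4)) = 12"
  using alt_group_card_carrier[of 4] by (simp add: fact_numeral)

context a4_extension
begin

text \<open>\<open>G\<close> acts on the four cosets of \<open>C\<close>. It is generated by the conjugates of \<open>x\<close>, which has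
  order \<open>3\<close> and therefore acts evenly.\<close>

lemma iso_alt_group_4:
  assumes K1: "card K = 1"
  shows "G \<cong> alt_group 4"
proof -
  have K_one: "K = {\<one>}" using K1 K.one_closed by (metis card_1_singletonE singletonD)
  define R where "R = rcosets C"
  have "card R * card C = 4 * card C"
    using lagrange[OF C.subgroup_axioms] index card_generate[OF x] by (simp add: C_def R_def)
  moreover have "card C > 0" using card_generate[OF x] ord_pos[OF x] by (simp add: C_def)
  ultimately have "card R = 4" by simp
  moreover have "finite R"
    using rcosets_subset_PowG[OF C.subgroup_axioms] by (auto simp: R_def intro: finite_subset)
  ultimately obtain b :: "nat \<Rightarrow> 'a set" where b: "bij_betw b {1..4} R"
    using ex_bij_betw_nat_finite_1[of R] by metis
  define d where "d = inv_into {1..4} b"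
  have d: "bij_betw d R {1..4}" unfolding d_def using b by (rule bij_betw_inv_into)
  have db: "d (b i) = i" if "i \<in> {1..4}" for i
    using that b by (simp add: d_def bij_betw_def)
  have bd: "b (d Y) = Y" if "Y \<in> R" for Y
    using that b by (simp add: d_def bij_betw_def f_inv_into_f)
  have bR: "b i \<in> R" if "i \<in> {1..4}" for i using that b by (rule bij_betwE[rule_format, rotated])
  have dR: "d Y \<in> {1..4}" if "Y \<in> R" for Y using that d by (rule bij_betwE[rule_format, rotated])
  have sub: "Y \<subseteq> carrier G" if "Y \<in> R" for Y
    using that C.rcosets_carrier[OF is_group] by (simp add: R_def)
  have shift: "Y #> g \<in> R" if Y: "Y \<in> R" and g: "g \<in> carrier G" for Y g
  proof -
    obtain a where a: "a \<in> carrier G" "Y = C #> a" using Y by (auto simp: R_def RCOSETS_def)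
    then have "Y #> g = C #> (a \<otimes> g)" using g C.subset by (simp add: coset_mult_assoc)
    then show ?thesis using a g C.subset by (simp add: R_def rcosetsI)
  qed
  have shift2: "Y #> g #> h = Y #> (g \<otimes> h)"
    if "Y \<in> R" "g \<in> carrier G" "h \<in> carrier G" for Y g h
    using that sub by (simp add: coset_mult_assoc)
  \<comment> \<open>Cosets are numbered by \<open>b\<close>; the inverse turns right multiplication
    into a left action, so that \<open>f\<close> respects composition. Points outside {1..4} stay
    fixed.\<close>
  define f where "f g i = (if i \<in> {1..4} then d (b i #> inv g) else i)" for g i
  have f_mult: "f (g \<otimes> h) = f g \<circ> f h" if g: "g \<in> carrier G" and h: "h \<in> carrier G" for g h
  proof
    fix i
    show "f (g \<otimes> h) i = (f g \<circ> f h) i"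
    proof (cases "i \<in> {1..4}")
      case True
      have "b i #> inv (g \<otimes> h) = b i #> inv h #> inv g"
        using shift2[OF bR[OF True]] g h by (simp add: inv_mult_group)
      then show ?thesis
        using True dR[OF shift[OF bR[OF True]], of "inv h"] bd[OF shift[OF bR[OF True]], of "inv h"] h
        by (simp add: f_def)
    qed (auto simp: f_def)
  qed
  have f_one: "f \<one> = id"
  proof
    fix i
    show "f \<one> i = id i" using db[of i] sub[OF bR[of i]] by (simp add: f_def coset_mult_one)
  qed
  have f_permutes: "f g permutes {1..4}" if g: "g \<in> carrier G" for g
  proof (rule bij_imp_permutes)
    have inv1: "f (inv g) \<circ> f g = id" and inv2: "f g \<circ> f (inv g) = id"
      using f_mult[of "inv g" g] f_mult[of g "inv g"] g f_one by simp_all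
    have "f g i \<in> {1..4}" if "i \<in> {1..4}" "g \<in> carrier G" for i g
      using that dR[OF shift[OF bR[OF that(1)]], of "inv g"] by (simp add: f_def)
    then show "bij_betw (f g) {1..4} {1..4}"
      using g pointfree_idE[OF inv1] pointfree_idE[OF inv2]
      by (intro bij_betw_byWitness[where f' = "f (inv g)"]) auto
  qed (auto simp: f_def)
  have perm: "permutation (f g)" if "g \<in> carrier G" for g
    using f_permutes[OF that] by (auto simp: permutation_permutes)
  define e where "e g = sign (f g)" for g
  have e_mult: "e (g \<otimes> h) = e g * e h" if "g \<in> carrier G" "h \<in> carrier G" for g h
    using that f_mult perm by (simp add: e_def sign_compose)
  have e_one: "e \<one> = 1" by (simp add: e_def f_one)
  have e_sq: "e g * e g = 1" for g by (simp add: e_def sign_def)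
  have "carrier G \<subseteq> {g \<in> carrier G. e g = 1}"
  proof -
    obtain h where h: "h \<in> carrier G" "h \<notin> C" using ex_notin_C by auto
    have e_inv: "e (inv g) = e g" if "g \<in> carrier G" for g
      using e_mult[of "inv g" g] e_sq[of g] that e_one by (metis inv_closed l_inv mult.assoc mult.left_neutral mult.right_neutral)
    have "x [^] (3::nat) \<in> K" using x3_powers[of 1] by simp
    then have "x \<otimes> x \<otimes> x = \<one>" using K_one x by (simp add: numeral_3_eq_3)
    then have "e x * e x * e x = 1" using e_mult[of "x \<otimes> x" x] e_mult[of x x] x e_one by simp
    then have ex: "e x = 1" using e_sq[of x] by simp
    have "{g \<in> carrier G. e g = 1} = carrier G"
    proof (rule subgroup_eq_carrier)
      show "subgroup {g \<in> carrier G. e g = 1} G"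
        using e_mult e_inv e_one by (intro subgroupI) auto
      show "x \<in> {g \<in> carrier G. e g = 1}" using x ex by simp
      show "h \<otimes> x \<otimes> inv h \<in> {g \<in> carrier G. e g = 1}"
        using h x ex e_mult[of "h \<otimes> x" "inv h"] e_mult[of h x] e_inv[of h] e_sq[of h] by simp
      show "h \<otimes> x \<otimes> inv h \<notin> C" using conj_x h by simp
    qed
    then show ?thesis by simp
  qed
  then have even: "evenperm (f g)" if "g \<in> carrier G" for g
    using that by (auto simp: e_def sign_def split: if_splits)
  have hom: "f \<in> hom G (alt_group 4)"
    using f_permutes even f_mult by (intro homI) (auto simp: alt_group_carrier alt_group_mult)
  then interpret f: group_hom G "alt_group 4" f
    by (simp add: group_hom_def group_hom_axioms_def alt_group_is_group)
  have inj: "inj_on f (carrier G)"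
    unfolding f.inj_on_one_iff
  proof (intro allI impI)
    fix g assume g: "g \<in> carrier G" and "f g = \<one>\<^bsub>alt_group 4\<^esub>"
    then have "f g = id" by (simp add: alt_group_one)
    have fix_coset: "Y #> inv g = Y" if Y: "Y \<in> R" for Y
    proof -
      have "d (Y #> inv g) = d Y"
        using \<open>f g = id\<close> dR[OF Y] bd[OF Y] by (metis f_def id_apply)
      then show ?thesis using d Y shift[OF Y, of "inv g"] g by (metis bij_betw_def inj_on_eq_iff inv_closed)
    qed
    have inC: "a \<otimes> inv g \<otimes> inv a \<in> C" if a: "a \<in> carrier G" for a
    proof -
      have "C #> a \<in> R" using a C.subset by (simp add: R_def rcosetsI)
      then have "C #> (a \<otimes> inv g) = C #> a"
        using fix_coset[of "C #> a"] a g C.subset by (simp add: coset_mult_assoc)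
      then show ?thesis using coset_eq_iff[OF C.subgroup_axioms] a g by simp
    qed
    \<comment> \<open>An element of the kernel fixes every coset, so all conjugates of
      \<open>inv g\<close> lie in \<open>C\<close>. For a power of \<open>x\<close> this means an
      exponent divisible by 3, hence membership in the trivial group \<open>K\<close>.\<close>
    obtain i :: nat where i: "inv g = x [^] i" using C_cases inC[of \<one>] g by auto
    obtain h where h: "h \<in> carrier G" "h \<notin> C" using ex_notin_C by auto
    have "3 dvd i" using conj_pow_notin_C[OF h] inC[OF h(1)] i by auto
    then have "inv g \<in> K" using x3_powers i by auto
    then show "g = \<one>" using K_one g by simp
  qed
  have "f ` carrier G = carrier (alt_group 4)"
  proof (rule card_subset_eq)
    show "finite (carrier (alt_group 4))" using card_alt_group_4 by (intro card_ge_0_finite) simp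
    show "card (f ` carrier G) = card (carrier (alt_group 4))"
      using inj order_eq K1 by (simp add: card_image card_alt_group_4 order_def)
  qed auto
  then show ?thesis using inj hom by (auto simp: is_iso_def iso_def bij_betw_def)
qed

end

lemma eq_power_2_power_3:
  assumes "(n::nat) > 0" "prime_factors n \<subseteq> {2, 3}"
  shows "\<exists>s t. n = 2 ^ s * 3 ^ t"
proof -
  have "n = (\<Prod>p\<in>prime_factors n. p ^ multiplicity p n)"
    using assms(1) by (rule prime_factorization_nat)
  also have "\<dots> = (\<Prod>p\<in>{2, 3}. p ^ multiplicity p n)"
    using assms
    by (intro prod.mono_neutral_left) (auto simp: prime_factors_dvd not_dvd_imp_multiplicity_0)
  finally show ?thesis by auto
qed

context finite_group
begin

text \<open>With n the group order and P the product over \<open>S\<close>, the chain 31 n^2 P <= 31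
  Psi(n) <= 77 psi(G) <= 77 n ord(x) is divided by n ord(x).\<close>

lemma exists_small_index_cyclic:
  assumes ge: "77 * psi G \<ge> 31 * cyclic_psi (order G)"
    and S: "finite S" "prime_factors (order G) \<subseteq> S"
  obtains x t where "x \<in> carrier G" "order G = t * ord x" "t > 0"
    "31 * (\<Prod>q\<in>S. real q / (real q + 1)) * real t \<le> 77"
proof -
  obtain x where x: "x \<in> carrier G" "psi G \<le> order G * ord x" using exists_large_ord by auto
  obtain t where t: "order G = t * ord x"
    using ord_dvd_group_order[OF x(1)] by (metis dvd_def mult.commute)
  have pos: "real (order G) > 0" "real (ord x) > 0" "t > 0"
    using order_pos ord_pos[OF x(1)] t by (auto intro: gr0I)
  define P where "P = (\<Prod>q\<in>S. real q / (real q + 1))"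
  have "31 * (real (order G) ^ 2 * P) \<le> 31 * real (cyclic_psi (order G))"
    using cyclic_psi_lower_bound[OF order_pos S] by (simp add: P_def)
  also have "\<dots> \<le> 77 * real (psi G)"
    using ge by (metis (mono_tags) of_nat_le_iff of_nat_mult of_nat_numeral)
  also have "\<dots> \<le> 77 * (real (order G) * real (ord x))"
    using x(2) by (simp flip: of_nat_mult)
  finally have "(real (order G) * real (ord x)) * (31 * P * real t) \<le> (real (order G) * real (ord x)) * 77"
    by (simp add: t power2_eq_square algebra_simps)
  then have "31 * P * real t \<le> 77"
    using pos by (simp add: mult_le_cancel_left_pos)
  then show ?thesis by (intro that[OF x(1) t pos(3)]) (simp add: P_def)
qed

lemma alt_group_4_if_2_3_group:
  assumes not_ss: "\<not> supersolvable G" and ge: "77 * psi G \<ge> 31 * cyclic_psi (order G)"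
    and factors: "prime_factors (order G) \<subseteq> {2, 3}"
  shows "77 * psi G = 31 * cyclic_psi (order G) \<and> G \<cong> alt_group 4"
proof -
  obtain x t where x: "x \<in> carrier G" and t: "order G = t * ord x" "t > 0"
    and "31 * (\<Prod>q\<in>{2, 3::nat}. real q / (real q + 1)) * real t \<le> 77"
    using exists_small_index_cyclic[OF ge _ factors] by auto
  \<comment> \<open>The product over 2 and 3 is 1/2, so t <= 154/31 < 5.\<close>
  then have "t \<le> 4" by simp
  moreover have "t \<noteq> 1" using supersolvable_if_ord_eq_order[OF x] not_ss t by auto
  moreover have "t \<noteq> 2" "t \<noteq> 3"
    using supersolvable_cyclic_prime_index[of 2, OF _ x] supersolvable_cyclic_prime_index[of 3, OF _ x]
      not_ss t by auto
  ultimately have "t = 4" using t(2) by linarith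
  then have index: "order G = 4 * ord x" using t by simp
  define C where "C = generate G {x}"
  have "\<not> (\<forall>g\<in>carrier G. g \<otimes> x [^] (2::nat) \<otimes> inv g \<in> C)"
    using supersolvable_index_four[OF x index] not_ss by (auto simp: C_def)
  then have cases: "\<forall>g\<in>carrier G - C. g \<otimes> x \<otimes> inv g \<notin> C \<and> g \<otimes> x [^] (2::nat) \<otimes> inv g \<notin> C \<and>
      g \<otimes> x [^] (3::nat) \<otimes> inv g \<in> C \<and>
      (\<forall>h\<in>carrier G - C. \<exists>i<3::nat. h \<otimes> inv (g \<otimes> x [^] i) \<in> C)"
    using index_four_cases[OF x index C_def] by argo
  interpret a4_extension G x C "generate G {x [^] (3::nat)}"
    using cases by unfold_locales (auto simp: x index C_def)
  let ?K = "generate G {x [^] (3::nat)}"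
  have "prime_factors (card ?K) \<subseteq> prime_factors (order G)"
    using order_eq order_pos by (intro dvd_prime_factors) auto
  then obtain s t where "card ?K = 2 ^ s * 3 ^ t"
    using eq_power_2_power_3[OF card_K_pos] factors by auto
  then have "card ?K = 1 \<and> 77 * psi G = 31 * cyclic_psi (order G)"
    using card_K_eq_1_if_psi_ge[of s t] ge order_eq by simp
  then show ?thesis using iso_alt_group_4 by simp
qed

text \<open>The Sylow \<open>p\<close>-subgroup lies in a cyclic subgroup of index less than \<open>p\<close>, so by the
  pigeonhole principle it fixes all cosets of that subgroup.\<close>

lemma normal_sylow_of_small_index:
  assumes p: "Factorial_Ring.prime p" and x: "x \<in> carrier G"
    and t: "order G = t * ord x" "0 < t" "t < p" and m: "order G = p ^ c * m" "\<not> p dvd m"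
  obtains y where "y \<in> carrier G" "ord y = p ^ c" "generate G {y} \<lhd> G"
proof -
  have cop: "coprime (p ^ c) e" if "0 < e" "e < p" for e
    using that p by (simp add: nat_dvd_not_less prime_imp_coprime)
  have "p ^ c dvd t * ord x" using m(1) t(1) by (metis dvd_triv_left)
  then have dvd: "p ^ c dvd ord x" using cop[OF t(2,3)] by (simp add: coprime_dvd_mult_right_iff)
  \<comment> \<open>Since \<open>t < p\<close>, the full power of \<open>p\<close> divides
    \<open>ord x\<close>, and \<open>y\<close> generates the Sylow subgroup inside the group
    generated by \<open>x\<close>.\<close>
  define y where "y = x [^] (ord x div p ^ c)"
  have yG: "y \<in> carrier G" using x by (simp add: y_def)
  have yC: "y \<in> generate G {x}" using x by (auto simp: y_def in_generate_iff)
  have pc: "p ^ c > 0" using p by (simp add: prime_gt_0_nat)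
  have "ord x div p ^ c \<noteq> 0" "ord x div (ord x div p ^ c) = p ^ c"
    using dvd ord_pos[OF x] pc by (auto elim!: dvdE)
  then have ord_y: "ord y = p ^ c"
    unfolding y_def using x dvd by (subst ord_pow) (auto simp: div_dvd_iff_mult)
  have "generate G {y} \<lhd> G"
  proof (rule normal_generate_singletonI[OF yG])
    fix g assume g: "g \<in> carrier G"
    have "order G < Suc t * card (generate G {x})"
      using t(1) ord_pos[OF x] x by (simp add: card_generate)
    then obtain i j where ij: "i < j" "j \<le> t" "g \<otimes> y [^] j \<otimes> inv (g \<otimes> y [^] i) \<in> generate G {x}"
      using coset_pigeonhole[OF subgroup_generate[OF x], of t "\<lambda>i. g \<otimes> y [^] i"] g yG by auto
    define e where "e = j - i"
    have "y [^] j = y [^] e \<otimes> y [^] i" using ij yG by (simp add: nat_pow_mult e_def)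
    moreover have "y [^] i \<otimes> (inv (y [^] i) \<otimes> inv g) = inv g"
      using g yG by (simp add: m_assoc[symmetric])
    ultimately have e: "g \<otimes> y [^] e \<otimes> inv g \<in> generate G {x}"
      using ij(3) g yG by (simp add: inv_mult_group m_assoc)
    \<comment> \<open>From 0 < e <= t < p, the element \<open>y\<close> is a power of
      \<open>y [^] e\<close>; so the conjugate of \<open>y\<close> itself, not only that of
      \<open>y [^] e\<close>, lies in the group generated by \<open>x\<close>.\<close>
    have "coprime e (ord y)" using cop[of e] ij t(3) ord_y by (simp add: e_def coprime_commute)
    then have "y \<in> generate G {y [^] e}" using yG by (intro in_generate_pow_coprime)
    then obtain r :: nat where "y = (y [^] e) [^] r" using yG by (auto simp: in_generate_iff)
    then have "g \<otimes> y \<otimes> inv g = (g \<otimes> y [^] e \<otimes> inv g) [^] r"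
      using conj_pow[OF g, of "y [^] e" r] yG by simp
    moreover obtain l :: nat where "g \<otimes> y [^] e \<otimes> inv g = x [^] l"
      using e x by (auto simp: in_generate_iff)
    ultimately have "g \<otimes> y \<otimes> inv g = x [^] (l * r)" using x by (simp add: nat_pow_pow)
    then have "g \<otimes> y \<otimes> inv g \<in> generate G {x}" using x by (auto simp: in_generate_iff)
    then show "g \<otimes> y \<otimes> inv g \<in> generate G {y}"
      using in_generate_if_ord_dvd[OF x yC] ord_conj[OF g yG] by simp
  qed
  then show ?thesis using that yG ord_y by blast
qed

lemma generate_iso_integer_mod_group:
  assumes "y \<in> carrier G"
  shows "G\<lparr>carrier := generate G {y}\<rparr> \<cong> integer_mod_group (ord y)"
proof -
  let ?P = "generate G {y}"
  have sub: "subgroup ?P G" using assms by (rule subgroup_generate)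
  have "finite ?P" using subgroup.subset[OF sub] finite_carrier by (rule finite_subset)
  then interpret P: finite_group "G\<lparr>carrier := ?P\<rparr>"
    using subgroup_imp_group[OF sub] by (simp add: finite_group_def finite_group_axioms_def)
  have yP: "y \<in> carrier (G\<lparr>carrier := ?P\<rparr>)" by (simp add: generate.incl)
  have "P.ord y = ord y"
    unfolding P.ord_unique[OF yP] using assms by (simp add: pow_eq_id flip: nat_pow_consistent)
  moreover have order: "order (G\<lparr>carrier := ?P\<rparr>) = ord y"
    using assms by (simp add: order_def card_generate)
  ultimately have "integer_mod_group (ord y) \<cong> G\<lparr>carrier := ?P\<rparr>"
    using P.cyclic_iso_integer_mod_group[OF yP] by simp
  then show ?thesis by (rule group.iso_sym[rotated]) simp
qed

end

lemma largest_prime_factor_ge_5: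
  assumes "n > (0::nat)" "\<not> prime_factors n \<subseteq> {2, 3}"
  obtains p where "Factorial_Ring.prime p" "p dvd n" "5 \<le> p" "prime_factors n \<subseteq> {2, 3} \<union> {5..p}"
proof -
  define p where "p = Max (prime_factors n)"
  have small: "q \<in> {2, 3} \<or> 5 \<le> q" if "Factorial_Ring.prime q" for q :: nat
  proof (rule ccontr)
    assume "\<not> ?thesis"
    then have "q = 4" using prime_gt_1_nat[OF that] by auto
    then have "2 dvd q" by simp
    then show False using that \<open>q = 4\<close> primes_dvd_imp_eq[OF two_is_prime_nat that] by simp
  qed
  obtain q where q: "q \<in> prime_factors n" "q \<notin> {2, 3}" using assms(2) by auto
  have "p \<in> prime_factors n" unfolding p_def using q by (intro Max_in) auto
  moreover have le: "r \<le> p" if "r \<in> prime_factors n" for r using that by (simp add: p_def)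
  moreover have "5 \<le> p" using le[OF q(1)] small[OF in_prime_factors_imp_prime[OF q(1)]] q(2) by auto
  moreover have "prime_factors n \<subseteq> {2, 3} \<union> {5..p}"
  proof
    fix r assume r: "r \<in> prime_factors n"
    show "r \<in> {2, 3} \<union> {5..p}" using le[OF r] small[OF in_prime_factors_imp_prime[OF r]] by auto
  qed
  ultimately show ?thesis
    using that[OF in_prime_factors_imp_prime in_prime_factors_imp_dvd] by blast
qed

text \<open>The hypothesis is an inequality because only that is inherited by
  \<open>G Mod P\<close>; the equality in the conclusion for the quotient is what returns centrality
  of \<open>P\<close>.\<close>

lemma nat_group_classification:
  fixes G :: "nat monoid"
  assumes "finite_group G" "\<not> supersolvable G" "77 * psi G \<ge> 31 * cyclic_psi (order G)"
  shows "77 * psi G = 31 * cyclic_psi (order G) \<and>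
    (\<exists>m>0. coprime 6 m \<and> G \<cong> alt_group 4 \<times>\<times> integer_mod_group m)"
  using assms
proof (induction "order G" arbitrary: G rule: less_induct)
  case less
  interpret finite_group G by fact
  note not_ss = less.prems(2) and ge = less.prems(3)
  show ?case
  proof (cases "prime_factors (order G) \<subseteq> {2, 3}")
    case True
    then have *: "77 * psi G = 31 * cyclic_psi (order G)" "G \<cong> alt_group 4"
      using alt_group_4_if_2_3_group[OF not_ss ge] by auto
    have "alt_group 4 \<cong> alt_group 4 \<times>\<times> integer_mod_group 1"
    proof -
      have "(\<lambda>a. (a, 0)) \<in> iso (alt_group 4) (alt_group 4 \<times>\<times> integer_mod_group 1)"
        by (auto simp: iso_def hom_def bij_betw_def inj_on_def carrier_integer_mod_group image_iff)
      then show ?thesis by (rule is_isoI)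
    qed
    then have "G \<cong> alt_group 4 \<times>\<times> integer_mod_group 1" using *(2) iso_trans by blast
    then show ?thesis using *(1) by (intro conjI exI[of _ 1]) auto
  next
    case False
    then obtain p where p: "Factorial_Ring.prime p" "p dvd order G" "5 \<le> p"
      and factors: "prime_factors (order G) \<subseteq> {2, 3} \<union> {5..p}"
      using largest_prime_factor_ge_5[OF order_pos] by blast
    obtain x t where x: "x \<in> carrier G" and t: "order G = t * ord x" "t > 0"
      and bound: "31 * (\<Prod>q\<in>{2, 3} \<union> {5..p}. real q / (real q + 1)) * real t \<le> 77"
      using exists_small_index_cyclic[OF ge _ factors] by blast
    \<comment> \<open>Here 155 = 31 * 5 and 154 = 77 * 2; the margin of 1 gives
      \<open>t < p + 1\<close>.\<close>
    have "155 * real t \<le> 154 * (real p + 1)"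
      using bound unfolding prod_primes_telescope[OF p(3)] by (simp add: field_simps)
    then have "t \<le> p" by (cases "t \<ge> Suc p") (auto simp: not_le)
    moreover have "t \<noteq> p" using supersolvable_cyclic_prime_index[OF p(1) x] t not_ss by auto
    ultimately have "t < p" by simp
    define c where "c = multiplicity p (order G)"
    obtain m where m: "order G = p ^ c * m" "\<not> p dvd m"
      using multiplicity_decompose'[of "order G" p] order_pos p(1)
      by (metis c_def neq0_conv not_prime_unit)
    have "c > 0" using m p(2) by (cases c) auto
    obtain y where y: "y \<in> carrier G" "ord y = p ^ c" "generate G {y} \<lhd> G"
      using normal_sylow_of_small_index[OF p(1) x t \<open>t < p\<close> m] by blast
    define P where "P = generate G {y}"
    have normal: "P \<lhd> G" using y by (simp add: P_def)
    have cardP: "card P = p ^ c" using y by (simp add: P_def card_generate)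
    have pc: "p ^ c > 1" using p(1) \<open>c > 0\<close> by (metis one_less_power prime_gt_1_nat)
    interpret Q: finite_group "G Mod P" using normal by (rule finite_group_quotient)
    have orderQ: "order (G Mod P) = m"
    proof -
      have "order (G Mod P) * p ^ c = m * p ^ c"
        using order_quotient[OF normal] cardP m(1) by (simp add: mult.commute)
      then show ?thesis using pc by (metis mult_cancel2 not_less_zero)
    qed
    have m0: "m > 0" using Q.order_pos orderQ by simp
    have cop: "coprime (p ^ c) m" using p(1) m(2) by (simp add: prime_imp_coprime)
    have psi_mult: "cyclic_psi (order G) = cyclic_psi (p ^ c) * cyclic_psi m"
      using cyclic_psi_mult_coprime[OF cop _ m0] prime_gt_0_nat[OF p(1)] m(1) by simp
    have psi_le: "psi G \<le> cyclic_psi (p ^ c) * psi (G Mod P)"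
      using psi_normal_cyclic(1)[OF normal y(1) P_def] cop cardP orderQ by simp
    have psi_pos: "cyclic_psi (p ^ c) > 0"
      using cyclic_psi_prime_power[OF p(1), of c] by (metis Suc_eq_plus1 mult_0_right neq0_conv old.nat.distinct(2))
    have "cyclic_psi (p ^ c) * (31 * cyclic_psi m) \<le> cyclic_psi (p ^ c) * (77 * psi (G Mod P))"
    proof -
      have "cyclic_psi (p ^ c) * (31 * cyclic_psi m) = 31 * cyclic_psi (order G)"
        by (simp add: psi_mult)
      also have "\<dots> \<le> 77 * (cyclic_psi (p ^ c) * psi (G Mod P))"
        using ge psi_le by linarith
      finally show ?thesis by (simp only: mult.left_commute)
    qed
    then have geQ: "31 * cyclic_psi m \<le> 77 * psi (G Mod P)" using psi_pos by simp
    have not_ssQ: "\<not> supersolvable (G Mod P)"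
      using supersolvable_quotient[OF normal y(1) P_def] not_ss by blast
    obtain H :: "nat monoid" where H: "group H" "G Mod P \<cong> H" using Q.iso_nat_group by blast
    have finH: "finite_group H" using Q.finite_group_iso[OF H(2,1)] .
    have orderH: "order H = m" using order_iso[OF H(2)] orderQ by simp
    have psiH: "psi H = psi (G Mod P)" using psi_iso[OF Q.is_group H(1,2)] by simp
    have "m < order G" using m(1) m0 pc by simp
    then have IH: "77 * psi H = 31 * cyclic_psi m \<and>
        (\<exists>l>0. coprime 6 l \<and> H \<cong> alt_group 4 \<times>\<times> integer_mod_group l)"
      using less.hyps[of H] finH orderH psiH geQ not_ssQ supersolvable_iso[OF Q.is_group H(1,2)] by auto
    then obtain l where l: "l > 0" "coprime 6 l" "H \<cong> alt_group 4 \<times>\<times> integer_mod_group l" by auto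
    \<comment> \<open>The upper bound for \<open>psi G\<close> now coincides with the assumed lower
      bound, so it is attained.\<close>
    have eq77: "77 * (cyclic_psi (p ^ c) * psi (G Mod P)) = 31 * cyclic_psi (order G)"
      using IH psiH psi_mult by simp
    then have psi_eq: "psi G = cyclic_psi (card P) * psi (G Mod P)"
      using ge psi_le cardP by simp
    \<comment> \<open>Comparing orders shows that \<open>l\<close> divides \<open>m\<close> and is
      thus coprime to \<open>p\<close>, which lets the two cyclic factors merge.\<close>
    have m12: "m = 12 * l"
      using order_iso[OF l(3)] orderH order_integer_mod_group[OF l(1)] card_alt_group_4
      by (simp add: order_def card_cartesian_product)
    have "G \<cong> (G\<lparr>carrier := P\<rparr>) \<times>\<times> (G Mod P)"
      using psi_normal_cyclic(2)[OF normal y(1) P_def _ psi_eq] cop cardP orderQ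
      by (intro central_hall_subgroup_splits normal_imp_subgroup[OF normal]) auto
    also have "(G\<lparr>carrier := P\<rparr>) \<times>\<times> (G Mod P) \<cong>
        integer_mod_group (p ^ c) \<times>\<times> (alt_group 4 \<times>\<times> integer_mod_group l)"
    proof (intro DirProd_cong subgroup_imp_group[OF normal_imp_subgroup[OF normal]] Q.is_group)
      show "G\<lparr>carrier := P\<rparr> \<cong> integer_mod_group (p ^ c)"
        using generate_iso_integer_mod_group[OF y(1)] y(2) by (simp add: P_def)
    qed (rule iso_trans[OF H(2) l(3)])
    also have "\<dots> \<cong> (alt_group 4 \<times>\<times> integer_mod_group l) \<times>\<times> integer_mod_group (p ^ c)"
      by (rule DirProd_commute)
    also have "\<dots> \<cong> alt_group 4 \<times>\<times> (integer_mod_group l \<times>\<times> integer_mod_group (p ^ c))"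
      by (rule DirProd_assoc_iso)
    also have "\<dots> \<cong> alt_group 4 \<times>\<times> integer_mod_group (l * p ^ c)"
    proof (intro DirProd_cong iso_refl alt_group_is_group)
      have "coprime l (p ^ c)" using cop m12 by (simp add: coprime_commute)
      then have "integer_mod_group (l * p ^ c) \<cong> integer_mod_group l \<times>\<times> integer_mod_group (p ^ c)"
        using l(1) pc by (intro integer_mod_group_DirProd) (linarith | assumption)+
      then show "integer_mod_group l \<times>\<times> integer_mod_group (p ^ c) \<cong> integer_mod_group (l * p ^ c)"
        by (rule group.iso_sym[rotated]) simp
    qed (simp add: DirProd_group)
    finally have iso: "G \<cong> alt_group 4 \<times>\<times> integer_mod_group (l * p ^ c)" .
    have "\<not> p dvd 2 * 3"
    proof
      assume "p dvd 2 * 3"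
      then have "p dvd 2 \<or> p dvd 3" using p(1) by (simp only: prime_dvd_mult_iff)
      then show False using p(3) by (auto dest!: dvd_imp_le)
    qed
    then have "coprime 6 p" using p(1) by (simp add: prime_imp_coprime coprime_commute)
    then have "coprime 6 (l * p ^ c)" using l(2) by simp
    then show ?thesis
      using iso l(1) prime_gt_0_nat[OF p(1)] eq77 psi_eq cardP by (intro conjI exI[of _ "l * p ^ c"]) auto
  qed
qed

theorem theorem2p2:
  fixes G :: "('a, 'b) monoid_scheme"
  assumes "group G"
    and "finite (carrier G)"
    and "\<not> supersolvable G"
    and "real (psi G) = 31 / 77 * real (psi (integer_mod_group (order G)))"
  shows "\<exists>m::nat. m > 0 \<and> coprime 6 m \<and> G \<cong> alt_group 4 \<times>\<times> integer_mod_group m"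
proof -
  interpret finite_group G using assms(1,2) by (simp add: finite_group_def finite_group_axioms_def)
  obtain H :: "nat monoid" where H: "group H" "G \<cong> H" using iso_nat_group by blast
  have "real (77 * psi G) = real (31 * cyclic_psi (order G))"
    using assms(4) psi_integer_mod_group[OF order_pos] by simp
  then have "77 * psi G = 31 * cyclic_psi (order G)" by (simp only: of_nat_eq_iff)
  then have "77 * psi H \<ge> 31 * cyclic_psi (order H)"
    using psi_iso[OF is_group H] order_iso[OF H(2)] by simp
  moreover have "\<not> supersolvable H" using supersolvable_iso[OF is_group H] assms(3) by blast
  ultimately have "\<exists>m>0. coprime 6 m \<and> H \<cong> alt_group 4 \<times>\<times> integer_mod_group m"
    using nat_group_classification[OF finite_group_iso[OF H(2,1)]] by blast
  then show ?thesis using iso_trans[OF H(2)] by blast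
qed

end
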